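(* (1) There exist a sequence of values $q_s\in(0,1)$, $s=1,2,\ldots$, and, for each $s$, a pair of purely imaginary zeros $\pm i\rho_s$ (with $\rho_s>0$) of $\theta(q_s,\cdot)$, such that the modulus $\rho_s$ tends, as $s\rightarrow\infty$, to a quantity which is $\geq e^{\pi/2}=4.810477382\ldots$. (2) For every $q\in(0,0.2^{1/4}]$ (where $0.2^{1/4}=0.6687403050\ldots$), the function $\theta(q,\cdot)$ has no zeros with non-negative real part.
   Context: The partial theta function is $\theta(q,x):=\sum_{j=0}^{\infty}q^{j(j+1)/2}x^j$, where $q\in(0,1)$ is a parameter and $x\in\mathbb{C}$ is the variable; for each fixed $q\in(0,1)$ it is an entire function of $x$. *)

theory Defs
  imports "HOL-Analysis.Analysis"
begin

definition partial_theta :: "real \<Rightarrow> complex \<Rightarrow> complex" where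
  "partial_theta q x = (\<Sum>j. complex_of_real q ^ (j * (j + 1) div 2) * x ^ j)"

text \<open>The series converges absolutely for every \<open>x\<close>, so \<open>suminf\<close> is its genuine sum
  in the range of \<open>q\<close> considered.\<close>

lemma partial_theta_summable:
  fixes q :: real and x :: complex
  assumes "0 < q" "q < 1"
  shows "summable (\<lambda>j. norm (complex_of_real q ^ (j * (j + 1) div 2) * x ^ j))"
proof -
  define f where "f j = norm (complex_of_real q ^ (j * (j + 1) div 2) * x ^ j)" for j :: nat
  have step: "f (Suc n) = (q ^ Suc n * norm x) * f n" for n
  proof -
    have "Suc n * (Suc n + 1) div 2 = n * (n + 1) div 2 + Suc n"
      by simp
    then show ?thesis
      using assms by (simp add: f_def norm_mult norm_power power_add)
  qed
  have "(\<lambda>n. q ^ Suc n * norm x) \<longlonglongrightarrow> 0 * norm x"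
    using assms by (intro tendsto_mult tendsto_const LIMSEQ_Suc LIMSEQ_power_zero) auto
  then have "\<forall>\<^sub>F n in sequentially. q ^ Suc n * norm x < 1/2"
    by (intro order_tendstoD) auto
  then obtain N where N: "\<And>n. n \<ge> N \<Longrightarrow> q ^ Suc n * norm x < 1/2"
    by (auto simp: eventually_sequentially)
  have nonneg: "f n \<ge> 0" for n
    by (simp add: f_def)
  have "summable f"
  proof (rule summable_ratio_test[of "1/2" N])
    fix n assume "n \<ge> N"
    then have "f (Suc n) \<le> 1/2 * f n"
      unfolding step using N[of n] nonneg[of n] by (intro mult_right_mono) auto
    then show "norm (f (Suc n)) \<le> 1/2 * norm (f n)"
      using nonneg by simp
  qed simp
  then show ?thesis
    by (simp add: f_def[abs_def])
qed

end

theory Submission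
  imports Defs "HOL-Complex_Analysis.Complex_Analysis" "HOL-Real_Asymp.Real_Asymp"
begin

text \<open>Splitting the series into even and odd powers gives
  \<open>\<theta>(q, x) = \<theta>(q\<^sup>4, x\<^sup>2 / q) + q x \<theta>(q\<^sup>4, q x\<^sup>2)\<close>; on the imaginary axis the two summands are the real and
  the imaginary part, so imaginary zeros correspond to pairs of negative zeros of \<open>\<theta>(q\<^sup>4, \<cdot>)\<close> with
  quotient \<open>q\<^sup>2\<close>.

  (1) With \<open>Q = q\<^sup>4 = exp (-\<tau>)\<close>, the sum \<open>\<theta>(Q, x) + \<theta>(Q, 1 / x) / x\<close> is a Jacobi theta function, and the
  triple product shows that at \<open>x = - exp t\<close> it has size \<open>exp ((t\<^sup>2 - \<pi>\<^sup>2) / (2 \<tau>) + o(1 / \<tau>))\<close> as \<open>\<tau>\<close> tends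
  to \<open>0\<close>, while the second summand is of order \<open>1\<close>. So there are no zeros with \<open>t\<close> below \<open>\<pi> - \<epsilon>\<close>, and
  there are many with \<open>t\<close> near \<open>4\<close>. Between these two regimes the Poincare-Miranda theorem yields a
  pair of zeros with the required quotient. Letting \<open>\<epsilon>\<close> tend to \<open>0\<close> and passing to a subsequence gives
  the limit.

  (2) If \<open>q + q\<^sup>3 < 1\<close>, then at suitable points a single term of \<open>\<theta>(q\<^sup>4, \<cdot>)\<close>, and of each of its partial
  sums, dominates the rest. Hence the even and the odd part of a partial sum of \<open>\<theta>(q, \<cdot>)\<close> have
  interlacing negative zeros, so the partial sum has no zeros with positive real part (Hermite-Biehler),
  and Hurwitz's theorem passes this on to the limit. On the imaginary axis the same points show that
  the real and the imaginary part never vanish together.\<close>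

section \<open>Series identities and sign estimates\<close>

lemma triangle_Suc: "Suc j * (Suc j + 1) div 2 = j * (j + 1) div 2 + Suc j"
  by simp

lemma triangle_even: "2 * k * (2 * k + 1) div 2 = k * (2 * k + 1)" for k :: nat
  by simp

lemma triangle_odd: "(2 * k + 1) * (2 * k + 1 + 1) div 2 = (2 * k + 1) * (k + 1)" for k :: nat
  by simp

definition real_theta :: "real \<Rightarrow> real \<Rightarrow> real" where
  "real_theta q x = (\<Sum>j. q ^ (j * (j + 1) div 2) * x ^ j)"

lemma real_theta_summable_norm:
  assumes "0 < q" "q < 1"
  shows "summable (\<lambda>j. norm (q ^ (j * (j + 1) div 2) * x ^ j :: real))"
  using partial_theta_summable[OF assms, of "complex_of_real x"] assms
  by (simp add: norm_mult norm_power abs_mult power_abs)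

lemma real_theta_sums:
  assumes "0 < q" "q < 1"
  shows "(\<lambda>j. q ^ (j * (j + 1) div 2) * x ^ j) sums real_theta q x"
  unfolding real_theta_def using real_theta_summable_norm[OF assms, of x]
  by (rule summable_sums[OF summable_norm_cancel])

lemma partial_theta_sums:
  assumes "0 < q" "q < 1"
  shows "(\<lambda>j. complex_of_real q ^ (j * (j + 1) div 2) * x ^ j) sums partial_theta q x"
  unfolding partial_theta_def using partial_theta_summable[OF assms, of x]
  by (rule summable_sums[OF summable_norm_cancel])

lemma partial_theta_of_real:
  assumes "0 < q" "q < 1"
  shows "partial_theta q (of_real x) = of_real (real_theta q x)"
proof (rule sums_unique2)
  show "(\<lambda>j. complex_of_real q ^ (j * (j + 1) div 2) * of_real x ^ j) sums of_real (real_theta q x)"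
    using sums_of_real[OF real_theta_sums[OF assms, of x], where 'a = complex] by simp
qed (rule partial_theta_sums[OF assms])

text \<open>Partial sums of even length are a partial sum of \<open>f\<close> plus one of
  \<open>g\<close>; the assumed summability lets this subsequence determine the whole sum.\<close>

lemma even_odd_sums:
  fixes f g :: "nat \<Rightarrow> 'a :: real_normed_vector"
  assumes "summable (\<lambda>n. if even n then f (n div 2) else g (n div 2))"
    and "f sums a" "g sums b"
  shows "(\<lambda>n. if even n then f (n div 2) else g (n div 2)) sums (a + b)"
proof -
  let ?h = "\<lambda>n. if even n then f (n div 2) else g (n div 2)"
  have "(\<Sum>n<2 * N. ?h n) = (\<Sum>n<N. f n) + (\<Sum>n<N. g n)" for N
    by (induction N) (simp_all add: algebra_simps)
  moreover have "(\<lambda>N. (\<Sum>n<N. f n) + (\<Sum>n<N. g n)) \<longlonglongrightarrow> a + b"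
    using assms(2,3) unfolding sums_def by (rule tendsto_add)
  ultimately have "(\<lambda>N. \<Sum>n<2 * N. ?h n) \<longlonglongrightarrow> a + b"
    by simp
  moreover have "(\<lambda>N. \<Sum>n<N. ?h n) \<longlonglongrightarrow> suminf ?h"
    using summable_sums[OF assms(1)] by (simp add: sums_def)
  then have "(\<lambda>N. \<Sum>n<2 * N. ?h n) \<longlonglongrightarrow> suminf ?h"
    by (rule LIMSEQ_subseq_LIMSEQ[where f = "\<lambda>N. 2 * N", unfolded o_def]) (simp add: strict_mono_def)
  ultimately have "suminf ?h = a + b"
    by (rule LIMSEQ_unique[rotated])
  then show ?thesis
    using summable_sums[OF assms(1)] by simp
qed

text \<open>The exponent \<open>k * (2 * k + 1)\<close> falls short of four times the k-th
  triangular number by \<open>k\<close>; the missing \<open>q ^ k\<close> becomes the division of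
  \<open>x\<^sup>2\<close> by \<open>q\<close>. In the odd terms the exponent exceeds it by
  \<open>k + 1\<close>, whence the factor \<open>q\<close> and the argument
  \<open>q * x\<^sup>2\<close>.\<close>

lemma theta_even_term:
  fixes q x :: "'a :: field"
  assumes "q \<noteq> 0"
  shows "q ^ (2 * k * (2 * k + 1) div 2) * x ^ (2 * k) = (q ^ 4) ^ (k * (k + 1) div 2) * (x\<^sup>2 / q) ^ k"
proof -
  have "2 * (k * (k + 1) div 2) = k * (k + 1)"
    by (intro dvd_mult_div_cancel) simp
  then have "4 * (k * (k + 1) div 2) = k * (2 * k + 1) + k"
    unfolding distrib_left distrib_right by linarith
  then have "q ^ (4 * (k * (k + 1) div 2)) = q ^ (k * (2 * k + 1)) * q ^ k"
    by (simp only: power_add)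
  then show ?thesis
    using assms unfolding triangle_even power_mult[symmetric]
    by (simp add: power_divide power_mult[symmetric])
qed

lemma theta_odd_term:
  fixes q x :: "'a :: field"
  shows "q ^ ((2 * k + 1) * (2 * k + 1 + 1) div 2) * x ^ (2 * k + 1)
    = q * x * ((q ^ 4) ^ (k * (k + 1) div 2) * (q * x\<^sup>2) ^ k)"
proof -
  have "2 * (k * (k + 1) div 2) = k * (k + 1)"
    by (intro dvd_mult_div_cancel) simp
  then have "(2 * k + 1) * (k + 1) = 1 + (4 * (k * (k + 1) div 2) + k)"
    unfolding distrib_left distrib_right by linarith
  then have "q ^ ((2 * k + 1) * (k + 1)) = q * (q ^ (4 * (k * (k + 1) div 2)) * q ^ k)"
    by (simp only: power_add power_one_right)
  then show ?thesis
    unfolding triangle_odd power_mult[symmetric]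
    by (simp only: power_mult_distrib power_mult[symmetric] power_add power_one_right mult_ac)
qed

lemma partial_theta_split:
  assumes q: "0 < q" "q < 1"
  shows "partial_theta q x = partial_theta (q ^ 4) (x\<^sup>2 / q) + q * x * partial_theta (q ^ 4) (q * x\<^sup>2)"
proof -
  have q4: "0 < q ^ 4" "q ^ 4 < 1"
    using q by (auto simp: power_less_one_iff)
  define f g where "f k = complex_of_real (q ^ 4) ^ (k * (k + 1) div 2) * (x\<^sup>2 / q) ^ k"
    and "g k = q * x * (complex_of_real (q ^ 4) ^ (k * (k + 1) div 2) * (q * x\<^sup>2) ^ k)" for k
  have "complex_of_real q ^ (n * (n + 1) div 2) * x ^ n = (if even n then f (n div 2) else g (n div 2))" for n
  proof (cases "even n")
    case True
    then obtain k where "n = 2 * k" by (elim evenE)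
    then show ?thesis
      using theta_even_term[of "complex_of_real q" k x] q by (simp add: f_def)
  next
    case False
    then obtain k where "n = 2 * k + 1" by (elim oddE)
    then show ?thesis
      using theta_odd_term[of "complex_of_real q" k x] by (simp add: g_def)
  qed
  then have *: "(\<lambda>n. if even n then f (n div 2) else g (n div 2)) sums partial_theta q x"
    using partial_theta_sums[OF q, of x] by simp
  have "f sums partial_theta (q ^ 4) (x\<^sup>2 / q)"
    unfolding f_def[abs_def] by (rule partial_theta_sums[OF q4])
  moreover have "g sums (q * x * partial_theta (q ^ 4) (q * x\<^sup>2))"
    unfolding g_def[abs_def] by (rule sums_mult[OF partial_theta_sums[OF q4]])
  ultimately show ?thesis
    by (rule sums_unique2[OF * even_odd_sums[OF sums_summable[OF *]]])
qed

section \<open>Alternating sums dominated by one term\<close>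

text \<open>Peeling off the leading term leaves a sum of the same kind for the shifted sequence,
  with opposite sign; this is Leibniz's estimate for finite sums.\<close>

lemma alternating_sum_bounds:
  fixes a :: "nat \<Rightarrow> real"
  assumes "\<And>j. a j \<ge> 0" "\<And>j. Suc j < m \<Longrightarrow> a (Suc j) \<le> a j"
  shows "0 \<le> (\<Sum>j<m. (-1) ^ j * a j) \<and> (\<Sum>j<m. (-1) ^ j * a j) \<le> a 0"
  using assms
proof (induction m arbitrary: a)
  case (Suc m)
  have *: "(\<Sum>j<Suc m. (-1) ^ j * a j) = a 0 - (\<Sum>j<m. (-1) ^ j * a (Suc j))"
    by (subst sum.lessThan_Suc_shift) (simp add: sum_negf)
  have IH: "0 \<le> (\<Sum>j<m. (-1) ^ j * a (Suc j)) \<and> (\<Sum>j<m. (-1) ^ j * a (Suc j)) \<le> a (Suc 0)"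
    using Suc.prems by (intro Suc.IH) auto
  show ?case
  proof (cases m)
    case 0
    then show ?thesis using Suc.prems by simp
  next
    case (Suc k)
    then have "a (Suc 0) \<le> a 0"
      using Suc.prems by auto
    then show ?thesis
      using IH unfolding * by linarith
  qed
qed simp

text \<open>The part after the peak \<open>n\<close>, and the part before it read backwards, are
  alternating sums with decreasing terms. Each is bounded by the neighbour of the peak; for
  \<open>n = 0\<close> the left neighbour counts as \<open>0\<close>.\<close>

lemma unimodal_alternating_sum_ge:
  fixes T :: "nat \<Rightarrow> real"
  assumes T: "\<And>j. T j \<ge> 0" and up: "\<And>j. j < n \<Longrightarrow> T j \<le> T (Suc j)"
    and down: "\<And>j. n \<le> j \<Longrightarrow> T (Suc j) \<le> T j" and "n \<le> M"
  shows "(-1) ^ n * (\<Sum>j\<le>M. (-1) ^ j * T j) \<ge> T n - T (Suc n) - (if n = 0 then 0 else T (n - 1))"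
proof -
  have "(\<Sum>j\<le>M. (-1) ^ j * T j) = (\<Sum>j\<le>n + (M - n). (-1) ^ j * T j)"
    using \<open>n \<le> M\<close> by simp
  also have "\<dots> = (\<Sum>j<n. (-1) ^ j * T j) + (-1) ^ n * T n
      + (\<Sum>j=Suc n..n + (M - n). (-1) ^ j * T j)"
    unfolding sum_up_index_split by (simp flip: lessThan_Suc_atMost)
  also have "(\<Sum>j=Suc n..n + (M - n). (-1) ^ j * T j) = (\<Sum>j<M - n. (-1) ^ (Suc n + j) * T (Suc n + j))"
    using sum.shift_bounds_nat_ivl[of "\<lambda>j. (-1) ^ j * T j" 0 "Suc n" "M - n"]
    by (simp add: atLeast0LessThan add.commute atLeastLessThanSuc_atLeastAtMost)
  also have "\<dots> = - ((-1) ^ n * (\<Sum>j<M - n. (-1) ^ j * T (Suc n + j)))"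
    unfolding sum_distrib_left sum_negf[symmetric] by (simp add: power_add mult_ac)
  finally have "(-1) ^ n * (\<Sum>j\<le>M. (-1) ^ j * T j) = (-1) ^ n * (\<Sum>j<n. (-1) ^ j * T j)
      + ((-1) ^ n * (-1) ^ n) * T n - ((-1) ^ n * (-1) ^ n) * (\<Sum>j<M - n. (-1) ^ j * T (Suc n + j))"
    by (simp only: ring_distribs mult.assoc mult_minus_right diff_conv_add_uminus)
  then have "(-1) ^ n * (\<Sum>j\<le>M. (-1) ^ j * T j) = (-1) ^ n * (\<Sum>j<n. (-1) ^ j * T j) + T n
      - (\<Sum>j<M - n. (-1) ^ j * T (Suc n + j))"
    by (simp flip: power_mult_distrib)
  moreover have "(\<Sum>j<M - n. (-1) ^ j * T (Suc n + j)) \<le> T (Suc n)"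
    using alternating_sum_bounds[of "\<lambda>j. T (Suc n + j)" "M - n"] T down by simp
  moreover have "(-1) ^ n * (\<Sum>j<n. (-1) ^ j * T j) \<ge> - (if n = 0 then 0 else T (n - 1))"
  proof (cases n)
    case (Suc m)
    have "(\<Sum>j<n. (-1) ^ j * T j) = (\<Sum>j<n. (-1) ^ (n - Suc j) * T (n - Suc j))"
      by (rule sum.nat_diff_reindex[symmetric])
    also have "(-1) ^ n * \<dots> = - (\<Sum>j<n. (-1) ^ j * T (n - Suc j))"
      unfolding sum_distrib_left sum_negf[symmetric]
    proof (rule sum.cong)
      fix j assume "j \<in> {..<n}"
      then have "(-1 :: real) ^ n = (-1) ^ Suc j * (-1) ^ (n - Suc j)"
        unfolding power_add[symmetric] by simp
      then show "(-1) ^ n * ((-1) ^ (n - Suc j) * T (n - Suc j)) = - ((-1) ^ j * T (n - Suc j))"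
        by (simp flip: power_mult_distrib mult.assoc)
    qed simp
    finally have "(-1) ^ n * (\<Sum>j<n. (-1) ^ j * T j) = - (\<Sum>j<n. (-1) ^ j * T (n - Suc j))" .
    moreover have "(\<Sum>j<n. (-1) ^ j * T (n - Suc j)) \<le> T (n - Suc 0)"
    proof -
      have "T (n - Suc (Suc j)) \<le> T (n - Suc j)" if "Suc j < n" for j
        using up[of "n - Suc (Suc j)"] that by (simp add: Suc_diff_Suc)
      then show ?thesis
        using alternating_sum_bounds[of "\<lambda>j. T (n - Suc j)" n] T by simp
    qed
    ultimately show ?thesis
      using Suc by simp
  qed simp
  ultimately show ?thesis
    by linarith
qed

text \<open>With \<open>r\<close> the ratio of the terms \<open>n + 1\<close> and \<open>n\<close>, the two neighbours of the \<open>n\<close>-th term add up to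
  \<open>r + q ^ 4 / r\<close> times that term; this is at most \<open>q + q ^ 3\<close> for \<open>q ^ 3 \<le> r \<le> q\<close>.\<close>

lemma theta_partial_sum_sign:
  fixes q y :: real
  assumes q: "0 < q" "q + q ^ 3 < 1" and "n \<le> M"
    and r: "q ^ 3 \<le> (q ^ 4) ^ (n + 1) * y" "(q ^ 4) ^ (n + 1) * y \<le> q"
  shows "(-1) ^ n * (\<Sum>j\<le>M. (q ^ 4) ^ (j * (j + 1) div 2) * (-y) ^ j)
    \<ge> (q ^ 4) ^ (n * (n + 1) div 2) * y ^ n * (1 - q - q ^ 3)"
proof -
  define T where "T j = (q ^ 4) ^ (j * (j + 1) div 2) * y ^ j" for j
  define r where "r = (q ^ 4) ^ (n + 1) * y"
  have r_bounds: "q ^ 3 \<le> r" "r \<le> q"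
    using r by (auto simp: r_def)
  have "q ^ 3 > 0"
    using q by simp
  with q have "q < 1"
    by linarith
  have "r > 0"
    using r_bounds \<open>q ^ 3 > 0\<close> by linarith
  then have "y > 0"
    unfolding r_def by (rule zero_less_mult_pos) (use q in simp)
  have T_Suc: "T (Suc j) = T j * ((q ^ 4) ^ Suc j * y)" for j
    unfolding T_def triangle_Suc power_add by simp
  have T_pos: "T j > 0" for j
    using q \<open>y > 0\<close> by (simp add: T_def)
  have down: "T (Suc j) \<le> T j" if "n \<le> j" for j
  proof -
    have "(q ^ 4) ^ Suc j * y \<le> r"
      unfolding r_def using that q \<open>q < 1\<close> \<open>y > 0\<close>
      by (intro mult_right_mono power_decreasing) (auto simp: power_le_one)
    then have "(q ^ 4) ^ Suc j * y \<le> 1"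
      using r_bounds \<open>q < 1\<close> by linarith
    then show ?thesis
      unfolding T_Suc using T_pos[of j] by (simp add: mult_left_le)
  qed
  have r_eq: "r = q ^ 4 * ((q ^ 4) ^ n * y)"
    by (simp add: r_def)
  have "q ^ 4 \<le> q ^ 3"
    using q \<open>q < 1\<close> by (intro power_decreasing) auto
  have up: "T j \<le> T (Suc j)" if "j < n" for j
  proof -
    have "(q ^ 4) ^ n * y \<le> (q ^ 4) ^ Suc j * y"
      using that q \<open>q < 1\<close> \<open>y > 0\<close>
      by (intro mult_right_mono power_decreasing) (auto simp: power_le_one)
    moreover have "(q ^ 4) ^ n * y \<ge> 1"
    proof -
      have "q ^ 4 * 1 \<le> q ^ 4 * ((q ^ 4) ^ n * y)"
        using \<open>q ^ 4 \<le> q ^ 3\<close> r_bounds r_eq by linarith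
      then show ?thesis
        using q by (simp add: mult_le_cancel_left_pos)
    qed
    ultimately have "(q ^ 4) ^ Suc j * y \<ge> 1"
      by linarith
    then show ?thesis
      unfolding T_Suc using T_pos[of j] by simp
  qed
  have prev: "(if n = 0 then 0 else T (n - 1)) \<le> T n * (q ^ 4 / r)"
  proof (cases n)
    case (Suc m)
    have "T n * (q ^ 4 / r) = T m"
      using q \<open>y > 0\<close> by (simp add: Suc T_Suc r_def field_simps)
    then show ?thesis
      by (simp add: Suc)
  qed (use T_pos \<open>r > 0\<close> q in \<open>simp add: less_imp_le\<close>)
  \<comment> \<open>The end points have product \<open>q ^ 4\<close> and sum
    \<open>q + q ^ 3\<close>, so dividing the expanded inequality by \<open>r\<close> bounds
    \<open>r + q ^ 4 / r\<close>.\<close>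
  have "(r - q) * (r - q ^ 3) \<le> 0"
    using r_bounds by (simp add: mult_nonpos_nonneg)
  then have "r * r + q ^ 4 \<le> (q + q ^ 3) * r"
    by (simp add: algebra_simps power3_eq_cube power4_eq_xxxx)
  then have "r + q ^ 4 / r \<le> q + q ^ 3"
    using \<open>r > 0\<close> by (simp add: field_simps)
  then have "T n * (1 - q - q ^ 3) \<le> T n * (1 - r - q ^ 4 / r)"
    using T_pos[of n] by (intro mult_left_mono) auto
  also have "\<dots> = T n - T (Suc n) - T n * (q ^ 4 / r)"
    by (simp add: T_Suc r_def algebra_simps)
  also have "\<dots> \<le> T n - T (Suc n) - (if n = 0 then 0 else T (n - 1))"
    using prev by linarith
  also have "\<dots> \<le> (-1) ^ n * (\<Sum>j\<le>M. (-1) ^ j * T j)"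
    using T_pos up down \<open>n \<le> M\<close> by (intro unimodal_alternating_sum_ge) (auto intro: less_imp_le)
  also have "(\<Sum>j\<le>M. (-1) ^ j * T j) = (\<Sum>j\<le>M. (q ^ 4) ^ (j * (j + 1) div 2) * (-y) ^ j)"
    by (intro sum.cong refl) (simp add: T_def power_minus[of y] mult_ac)
  finally show ?thesis
    by (simp add: T_def)
qed

text \<open>The lower bound for the partial sums is positive and does not depend on
  \<open>M\<close>, so the strict sign survives in the limit.\<close>

lemma real_theta_sign:
  fixes q y :: real
  assumes q: "0 < q" "q + q ^ 3 < 1"
    and r: "q ^ 3 \<le> (q ^ 4) ^ (n + 1) * y" "(q ^ 4) ^ (n + 1) * y \<le> q"
  shows "(-1) ^ n * real_theta (q ^ 4) (-y) > 0"
proof -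
  have "q ^ 3 > 0"
    using q by simp
  with q have "q < 1"
    by linarith
  have "(q ^ 4) ^ (n + 1) * y > 0"
    using r \<open>q ^ 3 > 0\<close> by linarith
  then have "y > 0"
    by (rule zero_less_mult_pos) (use q in simp)
  have "(\<lambda>M. \<Sum>j\<le>M. (q ^ 4) ^ (j * (j + 1) div 2) * (-y) ^ j) \<longlonglongrightarrow> real_theta (q ^ 4) (-y)"
    using real_theta_sums[of "q ^ 4" "-y"] q \<open>q < 1\<close> by (simp add: sums_def_le power_less_one_iff)
  then have "(\<lambda>M. (-1) ^ n * (\<Sum>j\<le>M. (q ^ 4) ^ (j * (j + 1) div 2) * (-y) ^ j))
      \<longlonglongrightarrow> (-1) ^ n * real_theta (q ^ 4) (-y)"
    by (rule tendsto_mult_left)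
  moreover have "\<exists>N. \<forall>M\<ge>N. (q ^ 4) ^ (n * (n + 1) div 2) * y ^ n * (1 - q - q ^ 3)
      \<le> (-1) ^ n * (\<Sum>j\<le>M. (q ^ 4) ^ (j * (j + 1) div 2) * (-y) ^ j)"
    using theta_partial_sum_sign[OF q _ r] by blast
  ultimately have "(q ^ 4) ^ (n * (n + 1) div 2) * y ^ n * (1 - q - q ^ 3)
      \<le> (-1) ^ n * real_theta (q ^ 4) (-y)"
    by (rule LIMSEQ_le_const)
  moreover have "(q ^ 4) ^ (n * (n + 1) div 2) * y ^ n * (1 - q - q ^ 3) > 0"
    using q \<open>y > 0\<close> by simp
  ultimately show ?thesis
    by linarith
qed

text \<open>When \<open>y * q \<le> 1\<close> the terms decrease from the very first one, and the
  Leibniz estimate places the sum between its first two partial sums.\<close>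

lemma real_theta_pos_bounds:
  fixes q y :: real
  assumes q: "0 < q" "q < 1" and y: "0 \<le> y" "y * q \<le> 1"
  shows "1 - q * y \<le> real_theta q (-y)" "real_theta q (-y) \<le> 1"
proof -
  define T where "T j = q ^ (j * (j + 1) div 2) * y ^ j" for j
  have T_Suc: "T (Suc j) = T j * (q ^ Suc j * y)" for j
    unfolding T_def triangle_Suc power_add by simp
  have T_nonneg: "T j \<ge> 0" for j
    using q y by (simp add: T_def)
  have down: "T (Suc j) \<le> T j" for j
  proof -
    have "q ^ Suc j * y \<le> q * y"
      using q y by (intro mult_right_mono) (auto simp: mult_left_le power_le_one)
    then have "q ^ Suc j * y \<le> 1"
      using y by (simp add: mult.commute)
    then show ?thesis
      unfolding T_Suc using T_nonneg[of j] by (simp add: mult_left_le)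
  qed
  have T_eq: "(-1) ^ j * T j = q ^ (j * (j + 1) div 2) * (-y) ^ j" for j
    by (simp add: T_def power_minus[of y] mult_ac)
  have lim: "(\<lambda>M. \<Sum>j<M. (-1) ^ j * T j) \<longlonglongrightarrow> real_theta q (-y)"
    unfolding T_eq using real_theta_sums[OF q, of "-y"] by (simp add: sums_def)
  have T0: "T 0 = 1" "T (Suc 0) = q * y"
    by (simp_all add: T_def)
  have "1 - q * y \<le> (\<Sum>j<Suc M. (-1) ^ j * T j) \<and> (\<Sum>j<Suc M. (-1) ^ j * T j) \<le> 1" for M
  proof -
    have "(\<Sum>j<Suc M. (-1) ^ j * T j) = 1 - (\<Sum>j<M. (-1) ^ j * T (Suc j))"
      unfolding sum.lessThan_Suc_shift T0 by (simp add: sum_negf T0)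
    moreover have "0 \<le> (\<Sum>j<M. (-1) ^ j * T (Suc j)) \<and> (\<Sum>j<M. (-1) ^ j * T (Suc j)) \<le> T (Suc 0)"
      using T_nonneg down by (intro alternating_sum_bounds)
    ultimately show ?thesis
      unfolding T0(2) by linarith
  qed
  then show "1 - q * y \<le> real_theta q (-y)" "real_theta q (-y) \<le> 1"
    by (blast intro: LIMSEQ_le_const[OF LIMSEQ_Suc[OF lim]] LIMSEQ_le_const2[OF LIMSEQ_Suc[OF lim]])+
qed

section \<open>The Jacobi triple product\<close>

text \<open>The Gaussian binomial coefficient, given by a q-Pascal rule so that the q-binomial
  theorem involves no division. The truncated difference \<open>n - k\<close> is harmless: for
  \<open>k > n\<close> it multiplies a coefficient that is \<open>0\<close>.\<close>

fun qbinomial :: "real \<Rightarrow> nat \<Rightarrow> nat \<Rightarrow> real" where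
  "qbinomial q n 0 = 1"
| "qbinomial q 0 (Suc k) = 0"
| "qbinomial q (Suc n) (Suc k) = qbinomial q n (Suc k) + q ^ (n - k) * qbinomial q n k"

lemma qbinomial_eq_0: "n < k \<Longrightarrow> qbinomial q n k = 0"
  by (induction q n k rule: qbinomial.induct) auto

text \<open>The product over \<open>i < k\<close> stands for
  \<open>z ^ k * q ^ (k * (k - 1) div 2)\<close>. Multiplication by the new factor
  \<open>1 + z * q ^ M\<close> reproduces the q-Pascal rule.\<close>

lemma qbinomial_theorem:
  "(\<Prod>m<M. 1 + z * q ^ m) = (\<Sum>k\<le>M. qbinomial q M k * (\<Prod>i<k. z * q ^ i))"
proof (induction M)
  case (Suc M)
  define b where "b k = (\<Prod>i<k. z * q ^ i)" for k
  have "(\<Sum>k\<le>Suc M. qbinomial q (Suc M) k * b k)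
      = qbinomial q (Suc M) 0 * b 0 + (\<Sum>k\<le>M. qbinomial q (Suc M) (Suc k) * b (Suc k))"
    by (rule sum.atMost_Suc_shift)
  also have "(\<Sum>k\<le>M. qbinomial q (Suc M) (Suc k) * b (Suc k))
      = (\<Sum>k\<le>M. qbinomial q M (Suc k) * b (Suc k)) + (\<Sum>k\<le>M. (z * q ^ M) * (qbinomial q M k * b k))"
    unfolding sum.distrib[symmetric]
  proof (rule sum.cong)
    fix k assume "k \<in> {..M}"
    then have "q ^ M = q ^ (M - k) * q ^ k"
      unfolding power_add[symmetric] by simp
    then show "qbinomial q (Suc M) (Suc k) * b (Suc k)
        = qbinomial q M (Suc k) * b (Suc k) + (z * q ^ M) * (qbinomial q M k * b k)"
      by (simp add: b_def algebra_simps)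
  qed simp
  also have "qbinomial q (Suc M) 0 * b 0 + ((\<Sum>k\<le>M. qbinomial q M (Suc k) * b (Suc k)) + (\<Sum>k\<le>M. (z * q ^ M) * (qbinomial q M k * b k)))
      = (qbinomial q M 0 * b 0 + (\<Sum>k\<le>M. qbinomial q M (Suc k) * b (Suc k))) + (\<Sum>k\<le>M. (z * q ^ M) * (qbinomial q M k * b k))"
    by simp
  also have "qbinomial q M 0 * b 0 + (\<Sum>k\<le>M. qbinomial q M (Suc k) * b (Suc k)) = (\<Sum>k\<le>Suc M. qbinomial q M k * b k)"
    by (rule sum.atMost_Suc_shift[symmetric])
  also have "\<dots> = (\<Sum>k\<le>M. qbinomial q M k * b k)"
    by (simp add: qbinomial_eq_0)
  also have "\<dots> + (\<Sum>k\<le>M. (z * q ^ M) * (qbinomial q M k * b k)) = (\<Sum>k\<le>M. qbinomial q M k * b k) * (1 + z * q ^ M)"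
    unfolding sum_distrib_left[symmetric] by (simp add: algebra_simps)
  finally show ?case
    using Suc.IH by (simp add: b_def)
qed simp

text \<open>The q-Pochhammer symbol \<open>(q; q)_n\<close>, a partial product of the Euler
  function.\<close>

definition euler_prod :: "real \<Rightarrow> nat \<Rightarrow> real" where
  "euler_prod q n = (\<Prod>m<n. 1 - q ^ Suc m)"

lemma euler_prod_simps [simp]:
  "euler_prod q 0 = 1" "euler_prod q (Suc n) = euler_prod q n * (1 - q ^ Suc n)"
  by (simp_all add: euler_prod_def)

text \<open>The factorial formula cleared of denominators. By induction both summands of the Pascal
  rule become multiples of \<open>euler_prod q n\<close>, with weights \<open>1 - q ^ Suc i\<close>
  and \<open>q ^ Suc i * (1 - q ^ Suc j)\<close> that add up to
  \<open>1 - q ^ Suc n\<close>.\<close>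

lemma qbinomial_euler_prod:
  "k \<le> n \<Longrightarrow> qbinomial q n k * (euler_prod q k * euler_prod q (n - k)) = euler_prod q n"
proof (induction n arbitrary: k)
  case (Suc n)
  show ?case
  proof (cases k)
    case [simp]: (Suc j)
    show ?thesis
    proof (cases "j = n")
      case True
      then show ?thesis
        using Suc.IH[of n] by (auto simp: qbinomial_eq_0)
    next
      case False
      with Suc.prems have "j < n" by simp
      then obtain i where i: "n - j = Suc i" "n - Suc j = i" "n = j + Suc i"
        by (metis Suc_diff_Suc add_diff_inverse_nat less_imp_not_less)
      have 1: "qbinomial q n (Suc j) * (euler_prod q (Suc j) * euler_prod q i) = euler_prod q n"
        using Suc.IH[of "Suc j"] \<open>j < n\<close> i by (simp del: euler_prod_simps)
      have 2: "qbinomial q n j * (euler_prod q j * euler_prod q (Suc i)) = euler_prod q n"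
        using Suc.IH[of j] \<open>j < n\<close> i by (simp del: euler_prod_simps)
      have "qbinomial q (Suc n) k * (euler_prod q k * euler_prod q (Suc n - k))
          = (qbinomial q n (Suc j) * (euler_prod q (Suc j) * euler_prod q i)) * (1 - q ^ Suc i)
          + q ^ Suc i * (1 - q ^ Suc j) * (qbinomial q n j * (euler_prod q j * euler_prod q (Suc i)))"
        using i(1) by (simp add: algebra_simps)
      also have "\<dots> = euler_prod q n * (1 - q ^ Suc i * q ^ Suc j)"
        unfolding 1 2 by (simp add: algebra_simps)
      also have "q ^ Suc i * q ^ Suc j = q ^ Suc n"
        by (simp add: i(3) power_add)
      finally show ?thesis
        by simp
    qed
  qed simp
qed simp

text \<open>The q-binomial theorem with \<open>2 * N\<close> factors and
  \<open>z = x * q / q ^ N\<close>, which centres the product: the upper half of the factors is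
  \<open>1 + x * q ^ Suc m\<close>, the lower half \<open>1 + x / q ^ m\<close>. Dividing by the
  central product \<open>b N\<close> leaves nonnegative powers of \<open>x\<close> on one side of
  the centre and negative ones on the other.\<close>

lemma finite_triple_product:
  fixes q x :: real
  assumes "q \<noteq> 0" "x \<noteq> 0"
  shows "(\<Prod>m<N. 1 + x * q ^ Suc m) * (\<Prod>m<N. 1 + q ^ m / x)
    = (\<Sum>j\<le>N. qbinomial q (2 * N) (N + j) * (q ^ (j * (j + 1) div 2) * x ^ j))
      + (\<Sum>j<N. qbinomial q (2 * N) (N - Suc j) * (q ^ (j * (j + 1) div 2) * (1 / x) ^ j)) / x"
proof -
  define z where "z = x * q / q ^ N"
  define b where "b k = (\<Prod>i<k. z * q ^ i)" for k
  have b_Suc: "b (Suc k) = b k * (z * q ^ k)" for k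
    by (simp add: b_def)
  have "b N \<noteq> 0"
    using assms by (simp add: b_def z_def)
  have b_up: "b (N + j) = b N * (q ^ (j * (j + 1) div 2) * x ^ j)" for j
  proof (induction j)
    case (Suc j)
    have "b (N + Suc j) = b (N + j) * (x * q ^ Suc j)"
      using assms by (simp add: b_Suc z_def power_add)
    then show ?case
      unfolding Suc.IH triangle_Suc power_add by simp
  qed simp
  have step: "b (N - j) = b (N - Suc j) * (x / q ^ j)" if "j < N" for j
  proof -
    obtain i where i: "N = j + Suc i"
      using less_imp_Suc_add[OF \<open>j < N\<close>] by auto
    then have "N - j = Suc i" "N - Suc j = i"
      by auto
    moreover have "z * q ^ i = x / q ^ j"
      using assms by (simp add: z_def i power_add)
    ultimately show ?thesis
      by (simp add: b_Suc)
  qed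
  have b_down: "b (N - Suc j) = b N * (q ^ (j * (j + 1) div 2) * (1 / x) ^ j / x)" if "j < N" for j
    using that
  proof (induction j)
    case 0
    then show ?case
      using step[of 0] assms by simp
  next
    case (Suc j)
    have "b (N - Suc (Suc j)) = b (N - Suc j) * (q ^ Suc j / x)"
      using step[of "Suc j"] Suc.prems assms by simp
    also have "\<dots> = b N * (q ^ (j * (j + 1) div 2) * (1 / x) ^ j / x) * (q ^ Suc j / x)"
      using Suc by simp
    finally show ?case
      unfolding triangle_Suc power_add by simp
  qed
  have "b N = (\<Prod>i<N. x / q ^ i)"
  proof -
    have "b N = (\<Prod>i<N. z * q ^ (N - Suc i))"
      unfolding b_def by (rule prod.nat_diff_reindex[symmetric])
    also have "\<dots> = (\<Prod>i<N. x / q ^ i)"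
    proof (rule prod.cong)
      fix i assume "i \<in> {..<N}"
      then obtain k where "N = i + Suc k"
        using less_imp_Suc_add[of i N] by auto
      then show "z * q ^ (N - Suc i) = x / q ^ i"
        using assms by (simp add: z_def power_add)
    qed simp
    finally show ?thesis .
  qed
  have "(\<Prod>m<2 * N. 1 + z * q ^ m) = (\<Prod>m<N. 1 + z * q ^ m) * (\<Prod>m<N. 1 + z * q ^ (N + m))"
    using prod.atLeastLessThan_concat[of 0 N "2 * N" "\<lambda>m. 1 + z * q ^ m"]
      prod.shift_bounds_nat_ivl[of "\<lambda>m. 1 + z * q ^ m" 0 N N]
    by (simp add: atLeast0LessThan add.commute mult_2)
  also have "(\<Prod>m<N. 1 + z * q ^ (N + m)) = (\<Prod>m<N. 1 + x * q ^ Suc m)"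
    using assms by (intro prod.cong refl) (simp add: z_def power_add)
  also have "(\<Prod>m<N. 1 + z * q ^ m) = (\<Prod>m<N. 1 + z * q ^ (N - Suc m))"
    by (rule prod.nat_diff_reindex[symmetric])
  \<comment> \<open>Pulling \<open>x / q ^ i\<close> out of each factor of the lower half collects
    exactly \<open>b N\<close>.\<close>
  also have "\<dots> = (\<Prod>i<N. (x / q ^ i) * (1 + q ^ i / x))"
  proof (rule prod.cong)
    fix i assume "i \<in> {..<N}"
    then obtain k where "N = i + Suc k"
      using less_imp_Suc_add[of i N] by auto
    then have "z * q ^ (N - Suc i) = x / q ^ i"
      using assms by (simp add: z_def power_add)
    then show "1 + z * q ^ (N - Suc i) = (x / q ^ i) * (1 + q ^ i / x)"
      using assms by (simp add: field_simps)
  qed simp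
  also have "\<dots> = b N * (\<Prod>m<N. 1 + q ^ m / x)"
    using \<open>b N = (\<Prod>i<N. x / q ^ i)\<close> by (simp only: prod.distrib)
  finally have lhs: "(\<Prod>m<2 * N. 1 + z * q ^ m)
      = b N * ((\<Prod>m<N. 1 + x * q ^ Suc m) * (\<Prod>m<N. 1 + q ^ m / x))"
    by (simp add: mult_ac)
  have "{..2 * N} = {..<N} \<union> {N..N + N}" "{..<N} \<inter> {N..N + N} = {}"
    by auto
  then have "(\<Sum>k\<le>2 * N. qbinomial q (2 * N) k * b k)
      = (\<Sum>k<N. qbinomial q (2 * N) k * b k) + (\<Sum>k=N..N + N. qbinomial q (2 * N) k * b k)"
    by (simp only: sum.union_disjoint finite_lessThan finite_atLeastAtMost)
  also have "(\<Sum>k<N. qbinomial q (2 * N) k * b k) = (\<Sum>j<N. qbinomial q (2 * N) (N - Suc j) * b (N - Suc j))"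
    by (rule sum.nat_diff_reindex[symmetric])
  also have "\<dots> = (\<Sum>j<N. b N * (qbinomial q (2 * N) (N - Suc j) * (q ^ (j * (j + 1) div 2) * (1 / x) ^ j) / x))"
    by (intro sum.cong refl) (simp add: b_down)
  also have "(\<Sum>k=N..N + N. qbinomial q (2 * N) k * b k) = (\<Sum>j\<le>N. qbinomial q (2 * N) (N + j) * b (N + j))"
    using sum.shift_bounds_cl_nat_ivl[of "\<lambda>k. qbinomial q (2 * N) k * b k" 0 N N]
    by (simp add: atLeast0AtMost add.commute)
  also have "\<dots> = (\<Sum>j\<le>N. b N * (qbinomial q (2 * N) (N + j) * (q ^ (j * (j + 1) div 2) * x ^ j)))"
    by (simp add: b_up mult_ac)
  finally have "b N * ((\<Prod>m<N. 1 + x * q ^ Suc m) * (\<Prod>m<N. 1 + q ^ m / x))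
    = b N * ((\<Sum>j\<le>N. qbinomial q (2 * N) (N + j) * (q ^ (j * (j + 1) div 2) * x ^ j))
      + (\<Sum>j<N. qbinomial q (2 * N) (N - Suc j) * (q ^ (j * (j + 1) div 2) * (1 / x) ^ j)) / x)"
    unfolding lhs[symmetric] qbinomial_theorem b_def[symmetric]
    by (simp add: sum_distrib_left[symmetric] sum_divide_distrib[symmetric] distrib_left)
  then show ?thesis
    using \<open>b N \<noteq> 0\<close> by simp
qed

section \<open>Size of the Euler function near 1\<close>

lemma euler_prod_pos: "0 < q \<Longrightarrow> q < 1 \<Longrightarrow> euler_prod q n > 0"
  unfolding euler_prod_def by (intro prod_pos) (simp add: power_less_one_iff del: power_Suc)

lemma decseq_euler_prod:
  assumes "0 < q" "q < 1"
  shows "decseq (euler_prod q)"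
proof (rule decseq_SucI)
  fix n
  have "1 - q ^ Suc n \<le> 1"
    using assms by simp
  then show "euler_prod q (Suc n) \<le> euler_prod q n"
    using euler_prod_pos[OF assms, of n] by (simp add: mult_left_le del: power_Suc)
qed

text \<open>Expanding each logarithm and exchanging the sums leaves, for every \<open>n\<close>, a
  geometric sum in \<open>q ^ n\<close>. At \<open>n = 0\<close> the quotient is \<open>0\<close> by
  the convention for division by zero.\<close>

lemma ln_euler_prod_sums:
  assumes "0 < q" "q < 1"
  shows "(\<lambda>n. (\<Sum>m<N. (q ^ n) ^ Suc m) / real n) sums (- ln (euler_prod q N))"
proof -
  have "(\<lambda>n. \<Sum>m<N. (q ^ Suc m) ^ n / real n) sums (\<Sum>m<N. - ln (1 - q ^ Suc m))"
  proof (rule sums_sum)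
    fix m
    have "\<bar>- (q ^ Suc m)\<bar> < 1"
      using assms by (simp add: power_less_one_iff del: power_Suc)
    from sums_minus[OF ln_series'[OF this]]
    show "(\<lambda>n. (q ^ Suc m) ^ n / real n) sums - ln (1 - q ^ Suc m)"
      by simp
  qed
  moreover have nz: "1 - q ^ Suc m \<noteq> 0" for m
    using power_Suc_less_one[OF assms, of m] by linarith
  then have "(\<Sum>m<N. - ln (1 - q ^ Suc m)) = - ln (euler_prod q N)"
    unfolding euler_prod_def sum_negf
    using nz by (subst ln_prod) auto
  moreover have "(\<Sum>m<N. (q ^ Suc m) ^ n / real n) = (\<Sum>m<N. (q ^ n) ^ Suc m) / real n" for n
    unfolding sum_divide_distrib power_mult[symmetric] by (simp add: mult.commute)
  ultimately show ?thesis
    by simp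
qed

lemma geometric_sum_Suc:
  fixes y :: real
  assumes "y \<noteq> 1"
  shows "(\<Sum>m<N. y ^ Suc m) = y * (1 - y ^ N) / (1 - y)"
  using sum_gp_strict[of y N] assms by (simp add: sum_distrib_left[symmetric])

lemma inverse_squares_sums': "(\<lambda>n. 1 / (real n)\<^sup>2) sums (pi\<^sup>2 / 6)"
  using sums_Suc[of "\<lambda>n. 1 / (real n)\<^sup>2"] inverse_squares_sums by (simp add: add.commute)

text \<open>Since \<open>exp s - 1 \<ge> s\<close>, the n-th term of the series for the negative
  logarithm is at most \<open>1 / (\<tau> * (real n)\<^sup>2)\<close>, and these bounds sum to
  \<open>pi\<^sup>2 / 6 / \<tau>\<close>, uniformly in \<open>N\<close>.\<close>

lemma euler_prod_ge:
  assumes "\<tau> > 0"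
  shows "euler_prod (exp (-\<tau>)) N \<ge> exp (- (pi\<^sup>2 / 6) / \<tau>)"
proof -
  have q: "0 < exp (-\<tau>)" "exp (-\<tau>) < 1"
    using assms by auto
  have "(\<Sum>m<N. (exp (-\<tau>) ^ n) ^ Suc m) / real n \<le> (1 / \<tau>) * (1 / (real n)\<^sup>2)" for n
  proof (cases "n = 0")
    case False
    define y where "y = exp (-\<tau>) ^ n"
    have y: "0 < y" "y < 1"
      using False q by (simp_all add: y_def power_less_one_iff del: exp_less_one_iff)
    have y_eq: "y = 1 / exp (real n * \<tau>)"
      unfolding y_def exp_of_nat_mult[symmetric] by (simp add: exp_minus inverse_eq_divide)
    have "(\<Sum>m<N. y ^ Suc m) = y * (1 - y ^ N) / (1 - y)"
      using y by (intro geometric_sum_Suc) auto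
    also have "\<dots> \<le> y / (1 - y)"
      using y by (intro divide_right_mono) (auto simp: mult_left_le)
    also have "\<dots> = 1 / (exp (real n * \<tau>) - 1)"
      by (simp add: y_eq field_simps)
    also have "\<dots> \<le> 1 / (real n * \<tau>)"
    proof (rule divide_left_mono)
      show "real n * \<tau> \<le> exp (real n * \<tau>) - 1"
        using exp_ge_add_one_self[of "real n * \<tau>"] by linarith
    qed (use assms False in auto)
    finally have "(\<Sum>m<N. y ^ Suc m) / real n \<le> 1 / (real n * \<tau>) / real n"
      by (rule divide_right_mono) simp
    then show ?thesis
      by (simp add: y_def power2_eq_square mult_ac)
  qed simp
  then have "- ln (euler_prod (exp (-\<tau>)) N) \<le> (1 / \<tau>) * (pi\<^sup>2 / 6)"
    by (rule sums_le[OF _ ln_euler_prod_sums[OF q] sums_mult[OF inverse_squares_sums']])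
  then have "- (pi\<^sup>2 / 6) / \<tau> \<le> ln (euler_prod (exp (-\<tau>)) N)"
    by simp
  then show ?thesis
    using euler_prod_pos[OF q, of N] by (simp add: ln_ge_iff)
qed

definition euler_function :: "real \<Rightarrow> real" where
  "euler_function q = lim (euler_prod q)"

text \<open>The finite products decrease and, with \<open>q = exp (-\<tau>)\<close>, stay above a
  positive bound independent of their length; so they converge and the limit inherits the
  bound.\<close>

lemma
  assumes "0 < q" "q < 1"
  shows euler_prod_tendsto: "euler_prod q \<longlonglongrightarrow> euler_function q"
    and euler_function_le_prod: "euler_function q \<le> euler_prod q N"
    and euler_function_ge: "euler_function q \<ge> exp (pi\<^sup>2 / 6 / ln q)"
    and euler_function_pos: "euler_function q > 0"
proof -
  define \<tau> where "\<tau> = - ln q"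
  have \<tau>: "\<tau> > 0" "q = exp (-\<tau>)"
    using assms by (simp_all add: \<tau>_def)
  have ge: "euler_prod q n \<ge> exp (- (pi\<^sup>2 / 6) / \<tau>)" for n
    unfolding \<tau>(2) by (rule euler_prod_ge[OF \<tau>(1)])
  have lim: "euler_prod q \<longlonglongrightarrow> euler_function q"
    unfolding euler_function_def
    using decseq_convergent[OF decseq_euler_prod[OF assms], of 0] euler_prod_pos[OF assms]
    by (metis less_imp_le limI)
  show "euler_prod q \<longlonglongrightarrow> euler_function q"
    by (rule lim)
  show "euler_function q \<le> euler_prod q N"
    by (rule decseq_ge[OF decseq_euler_prod[OF assms] lim])
  have "euler_function q \<ge> exp (- (pi\<^sup>2 / 6) / \<tau>)"
    by (rule LIMSEQ_le_const[OF lim]) (use ge in blast)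
  moreover from this show "euler_function q \<ge> exp (pi\<^sup>2 / 6 / ln q)"
    by (simp add: \<tau>_def)
  ultimately show "euler_function q > 0"
    by (meson exp_gt_zero less_le_trans)
qed

text \<open>Counterpart of \<open>euler_prod_ge\<close>: the series for the negative logarithm has
  nonnegative terms, so finitely many of them bound it from below, and \<tau> times the n-th term
  tends to \<open>1 / (real n)\<^sup>2\<close>.\<close>

lemma eventually_ln_euler_function_le:
  assumes "\<epsilon> > 0"
  shows "eventually (\<lambda>\<tau>. ln (euler_function (exp (-\<tau>))) \<le> - (pi\<^sup>2 / 6 - \<epsilon>) / \<tau>) (at_right 0)"
proof -
  have "(\<lambda>K. \<Sum>n<K. 1 / (real n)\<^sup>2) \<longlonglongrightarrow> pi\<^sup>2 / 6"
    using inverse_squares_sums' by (simp add: sums_def)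
  then have "eventually (\<lambda>K. (\<Sum>n<K. 1 / (real n)\<^sup>2) > pi\<^sup>2 / 6 - \<epsilon>) sequentially"
    by (rule order_tendstoD) (use assms in simp)
  \<comment> \<open>\<open>K\<close> depends on \<epsilon> only; keeping it fixed reduces the limit
    in \<tau> to that of a finite sum.\<close>
  then obtain K where K: "(\<Sum>n<K. 1 / (real n)\<^sup>2) > pi\<^sup>2 / 6 - \<epsilon>"
    by (auto simp: eventually_sequentially)
  have "((\<lambda>\<tau>. \<tau> / (exp (real n * \<tau>) - 1) / real n) \<longlongrightarrow> 1 / (real n)\<^sup>2) (at_right 0)" for n
  proof (cases "n = 0")
    case False
    then have "real n > 0"
      by simp
    then have "((\<lambda>\<tau>. \<tau> / (exp (real n * \<tau>) - 1)) \<longlongrightarrow> inverse (real n)) (at_right 0)"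
      by real_asymp
    then have "((\<lambda>\<tau>. \<tau> / (exp (real n * \<tau>) - 1) / real n) \<longlongrightarrow> inverse (real n) / real n) (at_right 0)"
      by (intro tendsto_divide tendsto_const) (use False in auto)
    then show ?thesis
      by (simp add: power2_eq_square divide_inverse)
  qed simp
  then have "((\<lambda>\<tau>. \<Sum>n<K. \<tau> / (exp (real n * \<tau>) - 1) / real n) \<longlongrightarrow> (\<Sum>n<K. 1 / (real n)\<^sup>2)) (at_right 0)"
    by (intro tendsto_sum)
  then have "eventually (\<lambda>\<tau>. (\<Sum>n<K. \<tau> / (exp (real n * \<tau>) - 1) / real n) > pi\<^sup>2 / 6 - \<epsilon>) (at_right 0)"
    using K by (rule order_tendstoD)
  moreover have "eventually (\<lambda>\<tau>::real. \<tau> > 0) (at_right 0)"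
    by (simp add: eventually_at_right_less)
  ultimately show ?thesis
  proof eventually_elim
    case (elim \<tau>)
    define q where "q = exp (-\<tau>)"
    have q: "0 < q" "q < 1"
      using elim by (auto simp: q_def)
    have "(\<Sum>n<K. (\<Sum>m<N. (q ^ n) ^ Suc m) / real n) \<le> - ln (euler_prod q N)" for N
      using sum_le_suminf[OF sums_summable[OF ln_euler_prod_sums[OF q, of N]], of "{..<K}"] q
        sums_unique[OF ln_euler_prod_sums[OF q, of N]]
      by (simp add: sum_nonneg)
    moreover have "(\<lambda>N. - ln (euler_prod q N)) \<longlonglongrightarrow> - ln (euler_function q)"
      using euler_function_pos[OF q] by (intro tendsto_intros euler_prod_tendsto q) simp
    moreover have "(\<lambda>N. \<Sum>n<K. (\<Sum>m<N. (q ^ n) ^ Suc m) / real n)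
        \<longlonglongrightarrow> (\<Sum>n<K. 1 / (exp (real n * \<tau>) - 1) / real n)"
    proof (rule tendsto_sum)
      fix n
      show "(\<lambda>N. (\<Sum>m<N. (q ^ n) ^ Suc m) / real n) \<longlonglongrightarrow> 1 / (exp (real n * \<tau>) - 1) / real n"
      proof (cases "n = 0")
        case False
        define y where "y = q ^ n"
        have y: "0 < y" "y < 1"
          using False q by (simp_all add: y_def power_less_one_iff)
        have y_eq: "y = 1 / exp (real n * \<tau>)"
          unfolding y_def q_def exp_of_nat_mult[symmetric] by (simp add: exp_minus inverse_eq_divide)
        have "(\<Sum>m<N. y ^ Suc m) = y * (1 - y ^ N) / (1 - y)" for N
          using y by (intro geometric_sum_Suc) auto
        moreover have "(\<lambda>N. y * (1 - y ^ N) / (1 - y)) \<longlonglongrightarrow> y * (1 - 0) / (1 - y)"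
          using y by (intro tendsto_intros LIMSEQ_power_zero) auto
        moreover have "y * (1 - 0) / (1 - y) = 1 / (exp (real n * \<tau>) - 1)"
          by (simp add: y_eq field_simps)
        ultimately have "(\<lambda>N. \<Sum>m<N. y ^ Suc m) \<longlonglongrightarrow> 1 / (exp (real n * \<tau>) - 1)"
          by simp
        then show ?thesis
          unfolding y_def by (intro tendsto_divide tendsto_const) (use False in auto)
      qed simp
    qed
    ultimately have "(\<Sum>n<K. 1 / (exp (real n * \<tau>) - 1) / real n) \<le> - ln (euler_function q)"
      by (intro LIMSEQ_le) auto
    then have "\<tau> * (\<Sum>n<K. 1 / (exp (real n * \<tau>) - 1) / real n) \<le> \<tau> * (- ln (euler_function q))"
      using elim by (intro mult_left_mono) auto
    then have "pi\<^sup>2 / 6 - \<epsilon> \<le> \<tau> * (- ln (euler_function q))"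
      using elim by (simp add: sum_distrib_left)
    then show ?case
      using elim by (simp add: q_def field_simps)
  qed
qed

section \<open>From the finite to the infinite triple product\<close>

text \<open>The bilateral series of \<open>q ^ (k * (k + 1) div 2) * x ^ k\<close> over all integers
  \<open>k\<close>: the second summand collects the indices \<open>k = - 1 - j\<close>, which have
  the same triangular exponent as \<open>j\<close>.\<close>

definition jacobi_theta :: "real \<Rightarrow> real \<Rightarrow> real" where
  "jacobi_theta q x = real_theta q x + real_theta q (1 / x) / x"

text \<open>\<open>C\<close> times the absolutely convergent theta series majorises all the sums;
  the vanishing of coefficients beyond \<open>N\<close> turns each finite sum into a full
  series.\<close>

lemma Tannery_theta:
  assumes q: "0 < q" "q < 1"
    and lim: "\<And>j. (\<lambda>N. a N j) \<longlonglongrightarrow> c" and bound: "\<And>N j. \<bar>a N j\<bar> \<le> C"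
    and fin: "\<And>N j. j > N \<Longrightarrow> a N j = 0"
  shows "(\<lambda>N. \<Sum>j\<le>N. a N j * (q ^ (j * (j + 1) div 2) * x ^ j)) \<longlonglongrightarrow> c * real_theta q x"
proof -
  define t where "t j = q ^ (j * (j + 1) div 2) * x ^ j" for j
  have "(\<lambda>N. \<Sum>j. a N j * t j) \<longlonglongrightarrow> (\<Sum>j. c * t j)"
  proof (rule tannerys_theorem[THEN conjunct2, THEN conjunct2])
    show "(\<lambda>N. a N j * t j) \<longlonglongrightarrow> c * t j" for j
      by (intro tendsto_intros lim)
    show "eventually (\<lambda>(j, N). norm (a N j * t j) \<le> C * norm (t j)) (at_top \<times>\<^sub>F sequentially)"
      using bound by (auto simp: abs_mult intro!: always_eventually mult_right_mono)
    show "summable (\<lambda>j. C * norm (t j))"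
      unfolding t_def by (intro summable_mult real_theta_summable_norm q)
  qed simp
  moreover have "(\<Sum>j. a N j * t j) = (\<Sum>j\<le>N. a N j * t j)" for N
    by (rule suminf_finite) (auto simp: fin not_le)
  moreover have "(\<Sum>j. c * t j) = c * real_theta q x"
    using sums_unique[OF sums_mult[OF real_theta_sums[OF q, of x]], of c] by (simp add: t_def)
  ultimately show ?thesis
    by (simp add: t_def)
qed

lemma qbinomial_eq:
  assumes "0 < q" "q < 1" "k \<le> n"
  shows "qbinomial q n k = euler_prod q n / (euler_prod q k * euler_prod q (n - k))"
  using qbinomial_euler_prod[OF assms(3), of q] euler_prod_pos[OF assms(1,2)]
  by (simp add: field_simps less_imp_neq[symmetric])

text \<open>The numerator is at most 1 and both factors of the denominator are at least the Euler
  function. Being uniform in \<open>n\<close> and \<open>k\<close>, the bound supplies the majorant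
  for the triple product.\<close>

lemma abs_qbinomial_le:
  assumes q: "0 < q" "q < 1"
  shows "\<bar>qbinomial q n k\<bar> \<le> 1 / (euler_function q)\<^sup>2"
proof (cases "k \<le> n")
  case True
  have L: "euler_function q > 0"
    by (rule euler_function_pos[OF q])
  have "euler_prod q n \<le> 1"
    using decseqD[OF decseq_euler_prod[OF q], of 0 n] by simp
  moreover have "euler_function q * euler_function q \<le> euler_prod q k * euler_prod q (n - k)"
    using L by (intro mult_mono euler_function_le_prod q) (auto intro: less_imp_le euler_prod_pos[OF q])
  ultimately have "qbinomial q n k \<le> 1 / (euler_function q)\<^sup>2"
    unfolding qbinomial_eq[OF q True] power2_eq_square
    using L euler_prod_pos[OF q] by (intro frac_le) (auto intro: less_imp_le)
  moreover have "qbinomial q n k \<ge> 0"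
    unfolding qbinomial_eq[OF q True] using euler_prod_pos[OF q] by (simp add: less_imp_le)
  ultimately show ?thesis
    by simp
qed (simp add: qbinomial_eq_0)

text \<open>At a fixed distance from the centre, the binomials of the finite identity tend to
  \<open>L / (L * L)\<close> with \<open>L\<close> the Euler function; the factor
  \<open>euler_prod q N\<close>, which tends to \<open>L\<close>, cancels this weight.\<close>

lemma jacobi_triple_product:
  assumes q: "0 < q" "q < 1" and "x \<noteq> 0"
  shows "(\<lambda>N. euler_prod q N * ((\<Prod>m<N. 1 + x * q ^ Suc m) * (\<Prod>m<N. 1 + q ^ m / x)))
    \<longlonglongrightarrow> jacobi_theta q x"
proof -
  define L where "L = euler_function q"
  have L: "L > 0"
    unfolding L_def by (rule euler_function_pos[OF q])
  have P: "(\<lambda>N. euler_prod q (f N)) \<longlonglongrightarrow> L" if "filterlim f at_top sequentially" for f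
    unfolding L_def by (rule filterlim_compose[OF euler_prod_tendsto[OF q] that])
  have 1: "(\<lambda>N. \<Sum>j\<le>N. (if j \<le> N then qbinomial q (2 * N) (N + j) else 0) * (q ^ (j * (j + 1) div 2) * x ^ j))
      \<longlonglongrightarrow> (1 / L) * real_theta q x"
  proof (rule Tannery_theta[OF q, where C = "1 / L\<^sup>2"])
    fix j
    have "(\<lambda>N. euler_prod q (2 * N) / (euler_prod q (N + j) * euler_prod q (N - j))) \<longlonglongrightarrow> L / (L * L)"
    proof (intro tendsto_divide tendsto_mult P)
      show "filterlim (\<lambda>N. 2 * N) at_top sequentially" "filterlim (\<lambda>N. N + j) at_top sequentially"
        by (rule filterlim_subseq, simp add: strict_mono_def)+
      show "filterlim (\<lambda>N. N - j) at_top sequentially"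
        by (rule filterlim_minus_const_nat_at_top)
    qed (use L in simp)
    moreover have "eventually (\<lambda>N. euler_prod q (2 * N) / (euler_prod q (N + j) * euler_prod q (N - j))
        = (if j \<le> N then qbinomial q (2 * N) (N + j) else 0)) sequentially"
      using eventually_ge_at_top[of j]
    proof eventually_elim
      case (elim N)
      then show ?case
        by (simp add: qbinomial_eq[OF q] mult_2)
    qed
    ultimately show "(\<lambda>N. if j \<le> N then qbinomial q (2 * N) (N + j) else 0) \<longlonglongrightarrow> 1 / L"
      using L by (simp add: tendsto_cong)
  qed (use abs_qbinomial_le[OF q] L in \<open>auto simp: L_def\<close>)
  \<comment> \<open>The inverse powers run over \<open>j < N\<close> only; at \<open>j = N\<close>
    the truncated \<open>N - Suc j\<close> would give a spurious coefficient, which is replaced by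
    \<open>0\<close>.\<close>
  have 2: "(\<lambda>N. \<Sum>j\<le>N. (if j < N then qbinomial q (2 * N) (N - Suc j) else 0) * (q ^ (j * (j + 1) div 2) * (1 / x) ^ j))
      \<longlonglongrightarrow> (1 / L) * real_theta q (1 / x)"
  proof (rule Tannery_theta[OF q, where C = "1 / L\<^sup>2"])
    fix j
    have "(\<lambda>N. euler_prod q (2 * N) / (euler_prod q (N - Suc j) * euler_prod q (N + Suc j))) \<longlonglongrightarrow> L / (L * L)"
    proof (intro tendsto_divide tendsto_mult P)
      show "filterlim (\<lambda>N. 2 * N) at_top sequentially" "filterlim (\<lambda>N. N + Suc j) at_top sequentially"
        by (rule filterlim_subseq, simp add: strict_mono_def)+
      show "filterlim (\<lambda>N. N - Suc j) at_top sequentially"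
        by (rule filterlim_minus_const_nat_at_top)
    qed (use L in simp)
    moreover have "eventually (\<lambda>N. euler_prod q (2 * N) / (euler_prod q (N - Suc j) * euler_prod q (N + Suc j))
        = (if j < N then qbinomial q (2 * N) (N - Suc j) else 0)) sequentially"
      using eventually_gt_at_top[of j]
    proof eventually_elim
      case (elim N)
      then have "2 * N - (N - Suc j) = N + Suc j" "N - Suc j \<le> 2 * N"
        by auto
      then show ?case
        using elim by (simp add: qbinomial_eq[OF q] del: euler_prod_simps)
    qed
    ultimately show "(\<lambda>N. if j < N then qbinomial q (2 * N) (N - Suc j) else 0) \<longlonglongrightarrow> 1 / L"
      using L by (simp add: tendsto_cong)
  qed (use abs_qbinomial_le[OF q] L in \<open>auto simp: L_def\<close>)
  have "(\<lambda>N. euler_prod q N * ((\<Sum>j\<le>N. (if j \<le> N then qbinomial q (2 * N) (N + j) else 0) * (q ^ (j * (j + 1) div 2) * x ^ j))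
      + (\<Sum>j\<le>N. (if j < N then qbinomial q (2 * N) (N - Suc j) else 0) * (q ^ (j * (j + 1) div 2) * (1 / x) ^ j)) / x))
      \<longlonglongrightarrow> L * ((1 / L) * real_theta q x + (1 / L) * real_theta q (1 / x) / x)"
    unfolding L_def using \<open>x \<noteq> 0\<close>
    by (intro tendsto_mult tendsto_add tendsto_divide tendsto_const 1[unfolded L_def] 2[unfolded L_def]
        euler_prod_tendsto q) auto
  moreover have "L * ((1 / L) * real_theta q x + (1 / L) * real_theta q (1 / x) / x) = jacobi_theta q x"
    using L \<open>x \<noteq> 0\<close> by (simp add: jacobi_theta_def field_simps)
  moreover have "(\<Sum>j\<le>N. (if j \<le> N then qbinomial q (2 * N) (N + j) else 0) * (q ^ (j * (j + 1) div 2) * x ^ j))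
      + (\<Sum>j\<le>N. (if j < N then qbinomial q (2 * N) (N - Suc j) else 0) * (q ^ (j * (j + 1) div 2) * (1 / x) ^ j)) / x
      = (\<Prod>m<N. 1 + x * q ^ Suc m) * (\<Prod>m<N. 1 + q ^ m / x)" for N
  proof -
    have "(\<Sum>j\<le>N. (if j < N then qbinomial q (2 * N) (N - Suc j) else 0) * (q ^ (j * (j + 1) div 2) * (1 / x) ^ j))
        = (\<Sum>j<N. qbinomial q (2 * N) (N - Suc j) * (q ^ (j * (j + 1) div 2) * (1 / x) ^ j))"
      by (rule sum.mono_neutral_cong_right) auto
    moreover have "(\<Sum>j\<le>N. (if j \<le> N then qbinomial q (2 * N) (N + j) else 0) * (q ^ (j * (j + 1) div 2) * x ^ j))
        = (\<Sum>j\<le>N. qbinomial q (2 * N) (N + j) * (q ^ (j * (j + 1) div 2) * x ^ j))"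
      by (rule sum.cong) auto
    ultimately show ?thesis
      using finite_triple_product[of q x N] q \<open>x \<noteq> 0\<close> by simp
  qed
  ultimately show ?thesis
    by simp
qed

section \<open>Imaginary zeros\<close>

lemma real_theta_rec:
  assumes "0 < q" "q < 1"
  shows "real_theta q x = 1 + q * x * real_theta q (q * x)"
proof -
  have "(\<lambda>j. q * x * (q ^ (j * (j + 1) div 2) * (q * x) ^ j)) sums (q * x * real_theta q (q * x))"
    by (intro sums_mult real_theta_sums assms)
  moreover have "q * x * (q ^ (j * (j + 1) div 2) * (q * x) ^ j)
      = q ^ (Suc j * (Suc j + 1) div 2) * x ^ Suc j" for j
    unfolding triangle_Suc power_add by (simp add: power_mult_distrib)
  ultimately have "(\<lambda>j. q ^ (Suc j * (Suc j + 1) div 2) * x ^ Suc j) sums (q * x * real_theta q (q * x))"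
    by (simp only:)
  from sums_unique2[OF real_theta_sums[OF assms, of x] sums_Suc[OF this]] show ?thesis
    by simp
qed

text \<open>The recurrences at \<open>x / q\<close> and at \<open>1 / x\<close> contribute constants
  \<open>1\<close> that cancel; on the bilateral series this is a shift of the index.\<close>

lemma jacobi_theta_shift:
  assumes "0 < q" "q < 1" "x \<noteq> 0"
  shows "jacobi_theta q (x / q) = x * jacobi_theta q x"
  using real_theta_rec[OF assms(1,2), of "x / q"] real_theta_rec[OF assms(1,2), of "1 / x"] assms
  by (simp add: jacobi_theta_def field_simps)

text \<open>Iterating the shift multiplies by \<open>- exp ((real k + \<beta>) * \<tau>)\<close> for
  each \<open>k < n\<close>. Estimates are thereby needed only for \<beta> between 0 and 1.\<close>

lemma jacobi_theta_exp_shift: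
  assumes "\<tau> > 0"
  shows "jacobi_theta (exp (-\<tau>)) (- exp ((real n + \<beta>) * \<tau>))
    = (-1) ^ n * exp ((real n * \<beta> + real n * (real n - 1) / 2) * \<tau>) * jacobi_theta (exp (-\<tau>)) (- exp (\<beta> * \<tau>))"
proof (induction n)
  case (Suc n)
  have "- exp ((real (Suc n) + \<beta>) * \<tau>) = - exp ((real n + \<beta>) * \<tau>) / exp (-\<tau>)"
    by (simp add: exp_diff[symmetric] algebra_simps)
  then have "jacobi_theta (exp (-\<tau>)) (- exp ((real (Suc n) + \<beta>) * \<tau>))
      = - exp ((real n + \<beta>) * \<tau>) * jacobi_theta (exp (-\<tau>)) (- exp ((real n + \<beta>) * \<tau>))"
    using jacobi_theta_shift[of "exp (-\<tau>)" "- exp ((real n + \<beta>) * \<tau>)"] assms by simp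
  also have "\<dots> = (-1) ^ Suc n * (exp ((real n + \<beta>) * \<tau>) * exp ((real n * \<beta> + real n * (real n - 1) / 2) * \<tau>))
      * jacobi_theta (exp (-\<tau>)) (- exp (\<beta> * \<tau>))"
    unfolding Suc.IH by simp
  also have "exp ((real n + \<beta>) * \<tau>) * exp ((real n * \<beta> + real n * (real n - 1) / 2) * \<tau>)
      = exp ((real (Suc n) * \<beta> + real (Suc n) * (real (Suc n) - 1) / 2) * \<tau>)"
    unfolding exp_add[symmetric] by (simp add: field_simps)
  finally show ?case .
qed simp

lemma jacobi_theta_exp_tendsto:
  assumes "\<tau> > 0"
  shows "(\<lambda>N. euler_prod (exp (-\<tau>)) N *
      ((\<Prod>m<N. 1 - exp (- (real (Suc m) - \<beta>) * \<tau>)) * (\<Prod>m<N. 1 - exp (- (real m + \<beta>) * \<tau>))))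
    \<longlonglongrightarrow> jacobi_theta (exp (-\<tau>)) (- exp (\<beta> * \<tau>))"
proof -
  have "1 + - exp (\<beta> * \<tau>) * exp (-\<tau>) ^ Suc m = 1 - exp (- (real (Suc m) - \<beta>) * \<tau>)" for m
    unfolding exp_of_nat_mult[symmetric] by (simp add: exp_add[symmetric] algebra_simps)
  moreover have "1 + exp (-\<tau>) ^ m / (- exp (\<beta> * \<tau>)) = 1 - exp (- (real m + \<beta>) * \<tau>)" for m
    unfolding exp_of_nat_mult[symmetric] by (simp add: exp_diff[symmetric] algebra_simps)
  ultimately show ?thesis
    using jacobi_triple_product[of "exp (-\<tau>)" "- exp (\<beta> * \<tau>)"] assms by simp
qed

lemma euler_prod_exp: "euler_prod (exp (-\<tau>)) N = (\<Prod>m<N. 1 - exp (- real (Suc m) * \<tau>))"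
  unfolding euler_prod_def exp_of_nat_mult[symmetric] by (simp only: mult_minus_left mult_minus_right)

text \<open>At \<beta> = 0 the second product, at \<beta> = 1 the first one has a vanishing factor
  of index 0, present as soon as \<open>N > 0\<close>.\<close>

lemma jacobi_theta_exp_0_1:
  assumes "\<tau> > 0" "\<beta> = 0 \<or> \<beta> = 1"
  shows "jacobi_theta (exp (-\<tau>)) (- exp (\<beta> * \<tau>)) = 0"
proof (rule LIMSEQ_unique[OF jacobi_theta_exp_tendsto[OF assms(1)]])
  have "eventually (\<lambda>N. euler_prod (exp (-\<tau>)) N *
      ((\<Prod>m<N. 1 - exp (- (real (Suc m) - \<beta>) * \<tau>)) * (\<Prod>m<N. 1 - exp (- (real m + \<beta>) * \<tau>))) = 0) sequentially"
    using eventually_gt_at_top[of 0]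
  proof eventually_elim
    case (elim N)
    then show ?case
      using assms(2) by auto
  qed
  then show "(\<lambda>N. euler_prod (exp (-\<tau>)) N *
      ((\<Prod>m<N. 1 - exp (- (real (Suc m) - \<beta>) * \<tau>)) * (\<Prod>m<N. 1 - exp (- (real m + \<beta>) * \<tau>)))) \<longlonglongrightarrow> 0"
    by (rule tendsto_eventually)
qed

text \<open>All factors are nonnegative, and each is at most the corresponding factor of
  \<open>euler_prod\<close>, because \<open>Suc m - \<beta>\<close> and \<open>m + \<beta>\<close>
  are at most \<open>Suc m\<close>; hence the cube.\<close>

lemma
  assumes \<tau>: "\<tau> > 0" and \<beta>: "0 \<le> \<beta>" "\<beta> \<le> 1"
  shows jacobi_theta_exp_nonneg: "0 \<le> jacobi_theta (exp (-\<tau>)) (- exp (\<beta> * \<tau>))"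
    and jacobi_theta_exp_le: "jacobi_theta (exp (-\<tau>)) (- exp (\<beta> * \<tau>)) \<le> euler_function (exp (-\<tau>)) ^ 3"
proof -
  have q: "0 < exp (-\<tau>)" "exp (-\<tau>) < 1"
    using \<tau> by auto
  define A B where "A N = (\<Prod>m<N. 1 - exp (- (real (Suc m) - \<beta>) * \<tau>))"
    and "B N = (\<Prod>m<N. 1 - exp (- (real m + \<beta>) * \<tau>))" for N
  have nonneg: "A N \<ge> 0" "B N \<ge> 0" for N
    unfolding A_def B_def using \<tau> \<beta> by (auto intro!: prod_nonneg mult_nonpos_nonneg mult_nonneg_nonneg)
  have le: "A N \<le> euler_prod (exp (-\<tau>)) N" "B N \<le> euler_prod (exp (-\<tau>)) N" for N
    unfolding A_def B_def euler_prod_exp using \<tau> \<beta>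
    by (auto intro!: prod_mono mult_right_mono mult_nonpos_nonneg)
  have lim: "(\<lambda>N. euler_prod (exp (-\<tau>)) N * (A N * B N)) \<longlonglongrightarrow> jacobi_theta (exp (-\<tau>)) (- exp (\<beta> * \<tau>))"
    unfolding A_def B_def by (rule jacobi_theta_exp_tendsto[OF \<tau>])
  have P: "euler_prod (exp (-\<tau>)) N > 0" for N
    by (rule euler_prod_pos[OF q])
  show "0 \<le> jacobi_theta (exp (-\<tau>)) (- exp (\<beta> * \<tau>))"
  proof (rule LIMSEQ_le_const[OF lim])
    have "0 \<le> euler_prod (exp (-\<tau>)) N * (A N * B N)" for N
      using nonneg[of N] P[of N] by simp
    then show "\<exists>M. \<forall>N\<ge>M. 0 \<le> euler_prod (exp (-\<tau>)) N * (A N * B N)"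
      by blast
  qed
  have "euler_prod (exp (-\<tau>)) N * (A N * B N) \<le> euler_prod (exp (-\<tau>)) N ^ 3" for N
    unfolding power3_eq_cube mult.assoc using nonneg[of N] le[of N] P[of N]
    by (intro mult_left_mono mult_mono) auto
  moreover have "(\<lambda>N. euler_prod (exp (-\<tau>)) N ^ 3) \<longlonglongrightarrow> euler_function (exp (-\<tau>)) ^ 3"
    by (intro tendsto_power euler_prod_tendsto q)
  ultimately show "jacobi_theta (exp (-\<tau>)) (- exp (\<beta> * \<tau>)) \<le> euler_function (exp (-\<tau>)) ^ 3"
    by (intro LIMSEQ_le[OF lim]) auto
qed

text \<open>Away from the zeros at \<beta> = 0 and \<beta> = 1, the factor of index 0 in either
  product is at least \<open>1 - exp (- \<tau> / 4)\<close>, and the remaining factors dominate the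
  Euler product. Cubing its lower bound \<open>exp (- (pi\<^sup>2 / 6) / \<tau>)\<close> gives the
  exponential.\<close>

lemma jacobi_theta_exp_ge:
  assumes \<tau>: "\<tau> > 0" and \<beta>: "1 / 4 \<le> \<beta>" "\<beta> \<le> 3 / 4"
  shows "(1 - exp (- \<tau> / 4))\<^sup>2 * exp (- (pi\<^sup>2 / 2) / \<tau>) \<le> jacobi_theta (exp (-\<tau>)) (- exp (\<beta> * \<tau>))"
proof -
  have q: "0 < exp (-\<tau>)" "exp (-\<tau>) < 1"
    using \<tau> by auto
  define L where "L = euler_function (exp (-\<tau>))"
  define c where "c = 1 - exp (- \<tau> / 4)"
  define A B where "A N = (\<Prod>m<N. 1 - exp (- (real (Suc m) - \<beta>) * \<tau>))"
    and "B N = (\<Prod>m<N. 1 - exp (- (real m + \<beta>) * \<tau>))" for N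
  have c: "c > 0"
    using \<tau> by (simp add: c_def)
  have P: "euler_prod (exp (-\<tau>)) N \<ge> L" for N
    unfolding L_def by (rule euler_function_le_prod[OF q])
  have L: "L > 0"
    unfolding L_def by (rule euler_function_pos[OF q])
  have AB: "c * L \<le> A (Suc N)" "c * L \<le> B (Suc N)" for N
  proof -
    have nonneg: "euler_prod (exp (-\<tau>)) N \<ge> 0"
      using P[of N] L by linarith
    have *: "(1 - exp (- (1 - \<beta>) * \<tau>)) * euler_prod (exp (-\<tau>)) N \<le> A (Suc N)"
      "(1 - exp (- \<beta> * \<tau>)) * euler_prod (exp (-\<tau>)) N \<le> B (Suc N)"
      unfolding A_def B_def euler_prod_exp prod.lessThan_Suc_shift using \<tau> \<beta>
      by (auto intro!: mult_left_mono prod_mono mult_right_mono mult_nonpos_nonneg mult_nonneg_nonneg)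
    have "c \<le> 1 - exp (- (1 - \<beta>) * \<tau>)" "c \<le> 1 - exp (- \<beta> * \<tau>)"
      using mult_right_mono[of "1 / 4" \<beta> \<tau>] mult_right_mono[of \<beta> "3 / 4" \<tau>] \<tau> \<beta>
      by (auto simp: c_def algebra_simps)
    then have "c * L \<le> (1 - exp (- (1 - \<beta>) * \<tau>)) * euler_prod (exp (-\<tau>)) N"
      "c * L \<le> (1 - exp (- \<beta> * \<tau>)) * euler_prod (exp (-\<tau>)) N"
      using P[of N] L c by (intro mult_mono; linarith)+
    with * show "c * L \<le> A (Suc N)" "c * L \<le> B (Suc N)"
      by linarith+
  qed
  have lim: "(\<lambda>N. euler_prod (exp (-\<tau>)) N * (A N * B N)) \<longlonglongrightarrow> jacobi_theta (exp (-\<tau>)) (- exp (\<beta> * \<tau>))"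
    unfolding A_def B_def by (rule jacobi_theta_exp_tendsto[OF \<tau>])
  have "L * ((c * L) * (c * L)) \<le> euler_prod (exp (-\<tau>)) (Suc N) * (A (Suc N) * B (Suc N))" for N
    using AB[of N] P[of "Suc N"] c L order_trans[OF less_imp_le[OF mult_pos_pos[OF c L]] AB(1)[of N]]
    by (intro mult_mono) (auto intro!: mult_nonneg_nonneg)
  then have "L * ((c * L) * (c * L)) \<le> jacobi_theta (exp (-\<tau>)) (- exp (\<beta> * \<tau>))"
    by (intro LIMSEQ_le_const[OF LIMSEQ_Suc[OF lim]]) blast
  moreover have "c\<^sup>2 * exp (- (pi\<^sup>2 / 2) / \<tau>) \<le> L * ((c * L) * (c * L))"
  proof -
    have "exp (- (pi\<^sup>2 / 6) / \<tau>) \<le> L"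
      using euler_function_ge[OF q] by (simp add: L_def)
    then have "exp (- (pi\<^sup>2 / 6) / \<tau>) ^ 3 \<le> L ^ 3"
      by (rule power_mono) simp
    moreover have "exp (- (pi\<^sup>2 / 6) / \<tau>) ^ 3 = exp (- (pi\<^sup>2 / 2) / \<tau>)"
      by (simp add: exp_of_nat_mult[symmetric])
    ultimately have "c\<^sup>2 * exp (- (pi\<^sup>2 / 2) / \<tau>) \<le> c\<^sup>2 * L ^ 3"
      by (simp add: mult_left_mono)
    then show ?thesis
      by (simp add: power2_eq_square power3_eq_cube mult_ac)
  qed
  ultimately show ?thesis
    by (simp add: c_def)
qed

section \<open>The two regimes of the ratio\<close>

text \<open>Minus the inverse-power half of the Jacobi theta function at \<open>- exp t\<close>,
  that is, the excess of \<open>real_theta\<close> over \<open>jacobi_theta\<close> there.\<close>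

definition theta_tail :: "real \<Rightarrow> real \<Rightarrow> real" where
  "theta_tail \<tau> t = exp (-t) * real_theta (exp (-\<tau>)) (- exp (-t))"

text \<open>For \<open>t > 0\<close> the argument \<open>exp (-t)\<close> is below 1 and the Leibniz
  bounds apply. The resulting bounds do not involve \<tau>, whereas the Jacobi part is exponential
  in \<open>1 / \<tau>\<close>.\<close>

lemma
  assumes "\<tau> > 0" "t > 0"
  shows theta_tail_ge: "theta_tail \<tau> t \<ge> exp (-t) * (1 - exp (-t))"
    and theta_tail_pos: "theta_tail \<tau> t > 0"
    and theta_tail_le: "theta_tail \<tau> t \<le> 1"
proof -
  have q: "0 < exp (-\<tau>)" "exp (-\<tau>) < 1"
    using assms by auto
  have y: "0 \<le> exp (-t)" "exp (-t) * exp (-\<tau>) \<le> 1" "exp (-t) < 1"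
    using assms by (auto simp: exp_add[symmetric])
  note bounds = real_theta_pos_bounds[OF q y(1,2)]
  have "exp (-\<tau>) * exp (-t) \<le> exp (-t)"
    using q by (simp add: mult_left_le_one_le)
  then have *: "1 - exp (-t) \<le> real_theta (exp (-\<tau>)) (- exp (-t))"
    using bounds(1) by linarith
  then show ge: "theta_tail \<tau> t \<ge> exp (-t) * (1 - exp (-t))"
    unfolding theta_tail_def by (intro mult_left_mono) auto
  have "exp (-t) * (1 - exp (-t)) > 0"
    using y by simp
  then show "theta_tail \<tau> t > 0"
    using ge by linarith
  have "exp (-t) * real_theta (exp (-\<tau>)) (- exp (-t)) \<le> 1 * 1"
  proof (rule mult_mono)
    show "0 \<le> real_theta (exp (-\<tau>)) (- exp (-t))"
      using * y(3) by linarith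
  qed (use bounds(2) y in auto)
  then show "theta_tail \<tau> t \<le> 1"
    by (simp add: theta_tail_def)
qed

lemma real_theta_exp_eq: "real_theta (exp (-\<tau>)) (- exp t) = jacobi_theta (exp (-\<tau>)) (- exp t) + theta_tail \<tau> t"
  by (simp add: jacobi_theta_def theta_tail_def exp_minus inverse_eq_divide)

text \<open>For odd \<open>n\<close> the sign \<open>(-1) ^ n\<close> makes this \<open>-1\<close> plus a nonnegative multiple of the Jacobi theta
  function.\<close>

definition theta_ratio :: "nat \<Rightarrow> real \<Rightarrow> real \<Rightarrow> real" where
  "theta_ratio n \<tau> \<beta> = - real_theta (exp (-\<tau>)) (- exp ((real n + \<beta>) * \<tau>)) / theta_tail \<tau> ((real n + \<beta>) * \<tau>)"

lemma theta_ratio_eq: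
  assumes "odd n" "\<tau> > 0" "\<beta> \<ge> 0"
  shows "theta_ratio n \<tau> \<beta> = exp ((real n * \<beta> + real n * (real n - 1) / 2) * \<tau>)
    * jacobi_theta (exp (-\<tau>)) (- exp (\<beta> * \<tau>)) / theta_tail \<tau> ((real n + \<beta>) * \<tau>) - 1"
proof -
  have "(real n + \<beta>) * \<tau> > 0"
    using assms by (auto intro!: mult_pos_pos add_pos_nonneg odd_pos)
  then show ?thesis
    using theta_tail_pos[OF assms(2), of "(real n + \<beta>) * \<tau>"] assms(1)
    unfolding theta_ratio_def real_theta_exp_eq jacobi_theta_exp_shift[OF assms(2)]
    by (simp add: field_simps)
qed

text \<open>With \<open>\<tau> = T / n\<close> the shift factor is at most
  \<open>exp (T\<^sup>2 / 2 / \<tau> + T / 2)\<close>, while the Jacobi part on [0, 1] decays almost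
  like \<open>exp (- (pi\<^sup>2 / 2) / \<tau>)\<close>; for \<open>T < pi\<close> their product
  drops below the tail.\<close>

lemma eventually_theta_ratio_nonpos:
  assumes "0 < T" "T < pi"
  shows "eventually (\<lambda>n. odd n \<longrightarrow> (\<forall>\<beta>\<in>{0..1}. theta_ratio n (T / real n) \<beta> \<le> 0)) sequentially"
proof -
  \<comment> \<open>Half of the gap between \<open>pi\<^sup>2 / 2\<close> and
    \<open>T\<^sup>2 / 2\<close>: an equal amount absorbs the error in the Euler function estimate,
    and \<open>c\<close> remains as decay rate.\<close>
  define c where "c = (pi\<^sup>2 - T\<^sup>2) / 4"
  \<comment> \<open>A lower bound for the tail, since \<open>t\<close> will lie between
    \<open>T\<close> and \<open>2 * T\<close>.\<close>
  define K where "K = exp (- (2 * T)) * (1 - exp (- T))"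
  have "c > 0"
    using assms by (simp add: c_def power_strict_mono)
  have "K > 0"
    using assms by (simp add: K_def)
  \<comment> \<open>The error is \<open>c / 3\<close> because the Euler function enters with its
    cube.\<close>
  have "eventually (\<lambda>\<tau>. ln (euler_function (exp (-\<tau>))) \<le> - (pi\<^sup>2 / 6 - c / 3) / \<tau>) (at_right 0)"
    using \<open>c > 0\<close> by (intro eventually_ln_euler_function_le) simp
  moreover have "((\<lambda>\<tau>. exp (- c / \<tau> + T / 2)) \<longlongrightarrow> 0) (at_right 0)"
    using \<open>c > 0\<close> by real_asymp
  then have "eventually (\<lambda>\<tau>. exp (- c / \<tau> + T / 2) < K) (at_right 0)"
    using \<open>K > 0\<close> by (rule order_tendstoD)
  ultimately have "eventually (\<lambda>\<tau>. exp (- c / \<tau> + T / 2) < K \<and>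
      ln (euler_function (exp (-\<tau>))) \<le> - (pi\<^sup>2 / 6 - c / 3) / \<tau>) (at_right 0)"
    by eventually_elim simp
  moreover have "filterlim (\<lambda>n. T / real n) (at_right 0) sequentially"
    using assms by real_asymp
  ultimately have "eventually (\<lambda>n. exp (- c / (T / real n) + T / 2) < K \<and>
      ln (euler_function (exp (- (T / real n)))) \<le> - (pi\<^sup>2 / 6 - c / 3) / (T / real n)) sequentially"
    by (rule eventually_compose_filterlim)
  then show ?thesis
  proof eventually_elim
    case (elim n)
    show ?case
    proof (intro impI ballI)
      fix \<beta> :: real assume n: "odd n" and \<beta>: "\<beta> \<in> {0..1}"
      define \<tau> where "\<tau> = T / real n"
      have "real n \<ge> 1"
        using odd_pos[OF n] by simp
      then have \<tau>: "\<tau> > 0" "real n * \<tau> = T" "\<tau> \<le> T"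
        using assms by (auto simp: \<tau>_def field_simps)
      have q: "0 < exp (-\<tau>)" "exp (-\<tau>) < 1"
        using \<tau> by auto
      define t where "t = (real n + \<beta>) * \<tau>"
      have "\<beta> * \<tau> \<le> 1 * \<tau>" "\<beta> * \<tau> \<ge> 0"
        using \<beta> \<tau> by (auto intro!: mult_right_mono)
      then have t: "T \<le> t" "t \<le> 2 * T"
        using \<tau> by (auto simp: t_def distrib_right)
      have "K \<le> exp (-t) * (1 - exp (-t))"
        unfolding K_def using t assms by (intro mult_mono) auto
      also have "\<dots> \<le> theta_tail \<tau> t"
        using t assms \<tau> by (intro theta_tail_ge) auto
      finally have tail: "K \<le> theta_tail \<tau> t" .
      have "euler_function (exp (-\<tau>)) \<le> exp (- (pi\<^sup>2 / 6 - c / 3) / \<tau>)"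
        using elim euler_function_pos[OF q] unfolding \<tau>_def by (metis exp_ln exp_le_cancel_iff)
      then have "euler_function (exp (-\<tau>)) ^ 3 \<le> exp (- (pi\<^sup>2 / 6 - c / 3) / \<tau>) ^ 3"
        using euler_function_pos[OF q] by (intro power_mono) auto
      also have "\<dots> = exp (- (pi\<^sup>2 / 2 - c) / \<tau>)"
      proof -
        have "pi\<^sup>2 / 2 - c = 3 * (pi\<^sup>2 / 6 - c / 3)"
          by simp
        then show ?thesis
          unfolding exp_of_nat_mult[symmetric]
          by (simp only: of_nat_numeral mult_minus_right times_divide_eq_right minus_divide_left)
      qed
      finally have D: "jacobi_theta (exp (-\<tau>)) (- exp (\<beta> * \<tau>)) \<le> exp (- (pi\<^sup>2 / 2 - c) / \<tau>)"
        using jacobi_theta_exp_le[OF \<tau>(1), of \<beta>] \<beta> by auto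
      have "(real n * \<beta> + real n * (real n - 1) / 2) * \<tau> \<le> (real n * 1 + real n * (real n - 1) / 2) * \<tau>"
        using \<beta> \<tau> by (intro mult_right_mono add_right_mono mult_left_mono) auto
      also have "\<dots> = T\<^sup>2 / 2 / \<tau> + T / 2"
        using \<tau>(1) by (simp add: \<tau>(2)[symmetric] power2_eq_square field_simps)
      finally have "exp ((real n * \<beta> + real n * (real n - 1) / 2) * \<tau>) * jacobi_theta (exp (-\<tau>)) (- exp (\<beta> * \<tau>))
        \<le> exp (T\<^sup>2 / 2 / \<tau> + T / 2) * exp (- (pi\<^sup>2 / 2 - c) / \<tau>)"
        using D jacobi_theta_exp_nonneg[OF \<tau>(1), of \<beta>] \<beta> by (intro mult_mono) auto
      also have "\<dots> = exp (- c / \<tau> + T / 2)"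
        unfolding exp_add[symmetric] using \<tau>(1) by (simp add: c_def field_simps)
      also have "\<dots> \<le> theta_tail \<tau> t"
        using tail elim by (simp add: \<tau>_def)
      finally show "theta_ratio n (T / real n) \<beta> \<le> 0"
        using theta_tail_pos[of \<tau> t] \<tau> t assms \<beta>
        unfolding \<tau>_def[symmetric] by (simp add: theta_ratio_eq[OF n] t_def[symmetric])
    qed
  qed
qed

text \<open>Here \<open>4\<close> is a convenient number above \<open>pi\<close>: with
  \<open>\<tau> = 4 / n\<close> the shift factor is at least \<open>exp (8 / \<tau> - 2)\<close>,
  which outweighs the decay \<open>exp (- (pi\<^sup>2 / 2) / \<tau>)\<close> in the lower bound of
  the Jacobi part, while the tail never exceeds 1.\<close>

lemma eventually_theta_ratio_nonneg:
  "eventually (\<lambda>n. odd n \<longrightarrow> (\<forall>\<beta>\<in>{1 / 4..3 / 4}. theta_ratio n (4 / real n) \<beta> \<ge> 0)) sequentially"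
proof -
  define c where "c = 8 - pi\<^sup>2 / 2"
  have "pi\<^sup>2 < 4\<^sup>2"
    using pi_less_4 by (intro power_strict_mono) auto
  then have "c > 0"
    by (simp add: c_def)
  have "eventually (\<lambda>\<tau>. (1 - exp (- \<tau> / 4))\<^sup>2 * exp (c / \<tau> - 2) \<ge> 1) (at_right 0)"
    using \<open>c > 0\<close> by real_asymp
  moreover have "filterlim (\<lambda>n. 4 / real n) (at_right 0) sequentially"
    by real_asymp
  ultimately have "eventually (\<lambda>n. (1 - exp (- (4 / real n) / 4))\<^sup>2 * exp (c / (4 / real n) - 2) \<ge> 1) sequentially"
    by (rule eventually_compose_filterlim)
  then show ?thesis
  proof eventually_elim
    case (elim n)
    show ?case
    proof (intro impI ballI)
      fix \<beta> :: real assume n: "odd n" and \<beta>: "\<beta> \<in> {1 / 4..3 / 4}"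
      define \<tau> where "\<tau> = 4 / real n"
      have "real n \<ge> 1"
        using odd_pos[OF n] by simp
      then have \<tau>: "\<tau> > 0" "real n * \<tau> = 4"
        by (auto simp: \<tau>_def field_simps)
      define t where "t = (real n + \<beta>) * \<tau>"
      have "t > 0"
        unfolding t_def using \<tau> \<beta> \<open>real n \<ge> 1\<close> by (intro mult_pos_pos) auto
      have "theta_tail \<tau> t \<le> 1"
        using theta_tail_le[OF \<tau>(1) \<open>t > 0\<close>] .
      also have "1 \<le> (1 - exp (- \<tau> / 4))\<^sup>2 * exp (c / \<tau> - 2)"
        using elim unfolding \<tau>_def .
      also have "c / \<tau> - 2 = - (pi\<^sup>2 / 2) / \<tau> + real n * (real n - 1) / 2 * \<tau>"
      proof -
        have "real n * (real n - 1) / 2 * \<tau> = 8 / \<tau> - 2"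
          using \<tau>(1) by (simp add: \<tau>_def field_simps)
        then show ?thesis
          by (simp add: c_def diff_divide_distrib)
      qed
      also have "(1 - exp (- \<tau> / 4))\<^sup>2 * exp \<dots>
        = exp (real n * (real n - 1) / 2 * \<tau>) * ((1 - exp (- \<tau> / 4))\<^sup>2 * exp (- (pi\<^sup>2 / 2) / \<tau>))"
        by (simp only: exp_add mult_ac)
      also have "\<dots> \<le> exp ((real n * \<beta> + real n * (real n - 1) / 2) * \<tau>) * jacobi_theta (exp (-\<tau>)) (- exp (\<beta> * \<tau>))"
        using jacobi_theta_exp_ge[OF \<tau>(1)] \<beta> \<tau> by (intro mult_mono) (auto simp: distrib_right)
      finally show "theta_ratio n (4 / real n) \<beta> \<ge> 0"
        using theta_tail_pos[OF \<tau>(1) \<open>t > 0\<close>] \<beta>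
        unfolding \<tau>_def[symmetric] by (simp add: theta_ratio_eq[OF n \<tau>(1)] t_def[symmetric])
    qed
  qed
qed

section \<open>Two equations in two unknowns\<close>

text \<open>Brouwer's theorem for the map that subtracts \<open>(f, g)\<close> from a point and
  clamps the result to the rectangle. At a fixed point a positive \<open>f\<close> forces
  \<open>x = a\<close> and a negative one \<open>x = b\<close>, both excluded by the signs on the
  sides; likewise for \<open>g\<close>.\<close>

lemma Poincare_Miranda_plane:
  fixes f g :: "real \<times> real \<Rightarrow> real"
  assumes "a \<le> b" "c \<le> d"
    and cont: "continuous_on ({a..b} \<times> {c..d}) f" "continuous_on ({a..b} \<times> {c..d}) g"
    and f: "\<And>y. y \<in> {c..d} \<Longrightarrow> f (a, y) \<le> 0" "\<And>y. y \<in> {c..d} \<Longrightarrow> f (b, y) \<ge> 0"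
    and g: "\<And>x. x \<in> {a..b} \<Longrightarrow> g (x, c) \<le> 0" "\<And>x. x \<in> {a..b} \<Longrightarrow> g (x, d) \<ge> 0"
  obtains x y where "x \<in> {a..b}" "y \<in> {c..d}" "f (x, y) = 0" "g (x, y) = 0"
proof -
  define h where "h z = (max a (min b (fst z - f z)), max c (min d (snd z - g z)))" for z
  obtain z where z: "z \<in> {a..b} \<times> {c..d}" "h z = z"
  proof (rule brouwer)
    show "compact ({a..b} \<times> {c..d})" "convex ({a..b} \<times> {c..d})"
      by (auto intro: compact_Times convex_Times)
    show "{a..b} \<times> {c..d} \<noteq> {}"
      using assms(1,2) by auto
    show "continuous_on ({a..b} \<times> {c..d}) h"
      unfolding h_def[abs_def] by (intro continuous_intros cont)
    show "h \<in> {a..b} \<times> {c..d} \<rightarrow> {a..b} \<times> {c..d}"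
      using assms(1,2) by (auto simp: h_def)
  qed
  obtain x y where xy: "z = (x, y)"
    by (cases z)
  have x: "x \<in> {a..b}" "max a (min b (x - f (x, y))) = x" and y: "y \<in> {c..d}" "max c (min d (y - g (x, y))) = y"
    using z by (auto simp: xy h_def)
  have "f (x, y) = 0"
  proof (rule ccontr)
    assume "f (x, y) \<noteq> 0"
    then have "x = a \<and> f (x, y) > 0 \<or> x = b \<and> f (x, y) < 0"
      using x by (auto simp: max_def min_def split: if_splits)
    then show False
      using f[OF y(1)] by auto
  qed
  moreover have "g (x, y) = 0"
  proof (rule ccontr)
    assume "g (x, y) \<noteq> 0"
    then have "y = c \<and> g (x, y) > 0 \<or> y = d \<and> g (x, y) < 0"
      using y by (auto simp: max_def min_def split: if_splits)
    then show False
      using g[OF x(1)] by auto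
  qed
  ultimately show ?thesis
    using that x(1) y(1) by blast
qed

text \<open>Joint continuity, because base and argument vary together in
  \<open>simultaneous_zeros\<close>. The M-test works on a neighbourhood where the base stays below
  some \<open>r < 1\<close> and the argument is bounded by \<open>B\<close>.\<close>

lemma continuous_on_real_theta: "continuous_on ({0<..<1} \<times> UNIV) (\<lambda>z. real_theta (fst z) (snd z))"
proof (rule continuous_at_imp_continuous_on, rule ballI)
  fix z :: "real \<times> real" assume z: "z \<in> {0<..<1} \<times> UNIV"
  then obtain r where r: "fst z < r" "r < 1"
    using dense[of "fst z" 1] by auto
  define B where "B = \<bar>snd z\<bar> + 1"
  define U where "U = {0<..<r} \<times> {-B<..<B}"
  have "0 < r" "0 \<le> B"
    using z r by (auto simp: B_def)
  have "uniform_limit U (\<lambda>n z. \<Sum>j<n. fst z ^ (j * (j + 1) div 2) * snd z ^ j)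
      (\<lambda>z. \<Sum>j. fst z ^ (j * (j + 1) div 2) * snd z ^ j) sequentially"
  proof (rule Weierstrass_m_test)
    show "summable (\<lambda>j. norm (r ^ (j * (j + 1) div 2) * B ^ j))"
      by (rule real_theta_summable_norm[OF \<open>0 < r\<close> r(2)])
    fix j and w :: "real \<times> real" assume "w \<in> U"
    then have "\<bar>fst w\<bar> \<le> r" "\<bar>snd w\<bar> \<le> B"
      by (auto simp: U_def)
    then have "\<bar>fst w\<bar> ^ (j * (j + 1) div 2) * \<bar>snd w\<bar> ^ j \<le> r ^ (j * (j + 1) div 2) * B ^ j"
      by (intro mult_mono power_mono) (use \<open>0 < r\<close> \<open>0 \<le> B\<close> in auto)
    then show "norm (fst w ^ (j * (j + 1) div 2) * snd w ^ j) \<le> norm (r ^ (j * (j + 1) div 2) * B ^ j)"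
      using \<open>0 < r\<close> \<open>0 \<le> B\<close> by (simp add: abs_mult power_abs)
  qed
  then have "continuous_on U (\<lambda>z. \<Sum>j. fst z ^ (j * (j + 1) div 2) * snd z ^ j)"
    by (rule uniform_limit_theorem[rotated]) (auto intro!: always_eventually continuous_intros)
  moreover have "open U" "z \<in> U"
    using z r by (auto simp: U_def B_def open_Times)
  ultimately show "isCont (\<lambda>z. real_theta (fst z) (snd z)) z"
    by (simp add: real_theta_def continuous_on_eq_continuous_at)
qed

lemma continuous_on_real_theta_compose [continuous_intros]:
  assumes "continuous_on S f" "continuous_on S g" "\<And>x. x \<in> S \<Longrightarrow> 0 < f x \<and> f x < 1"
  shows "continuous_on S (\<lambda>x. real_theta (f x) (g x))"
  using continuous_on_compose2[OF continuous_on_real_theta, of S "\<lambda>x. (f x, g x)"] assms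
  by (force intro: continuous_intros)

text \<open>For \<open>\<alpha> = 0\<close> and for \<open>\<alpha> = 1 / 2\<close> one of the two points is \<open>- exp \<tau> ^ n\<close> or \<open>- exp \<tau> ^ (n + 1)\<close>, where
  the Jacobi theta function vanishes and the ratio takes its least value \<open>-1\<close>. This fixes the sign
  of the difference of the two ratios on two sides of the rectangle; \<open>lower\<close> and \<open>upper\<close> fix the sign
  of their maximum on the other two sides.\<close>

lemma simultaneous_zeros:
  assumes n: "odd n" and \<tau>01: "0 < \<tau>0" "\<tau>0 \<le> \<tau>1"
    and lower: "\<And>\<beta>. \<beta> \<in> {0..1} \<Longrightarrow> theta_ratio n \<tau>0 \<beta> \<le> 0"
    and upper: "\<And>\<beta>. \<beta> \<in> {1 / 4..3 / 4} \<Longrightarrow> theta_ratio n \<tau>1 \<beta> \<ge> 0"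
  obtains \<alpha> \<tau> where "\<alpha> \<in> {0..1 / 2}" "\<tau> \<in> {\<tau>0..\<tau>1}"
    "real_theta (exp (-\<tau>)) (- exp ((real n + \<alpha>) * \<tau>)) = 0"
    "real_theta (exp (-\<tau>)) (- exp ((real n + \<alpha>) * \<tau> + \<tau> / 2)) = 0"
proof -
  define S where "S z = theta_ratio n (snd z) (fst z)" for z :: "real \<times> real"
  have npos: "real n > 0"
    using odd_pos[OF n] by simp
  have t_pos: "(real n + \<beta>) * \<tau> > 0" if "\<beta> \<ge> 0" "\<tau> > 0" for \<beta> \<tau>
    using that npos by (intro mult_pos_pos) auto
  have S_cont: "continuous_on ({0..1} \<times> {\<tau>0..\<tau>1}) S"
    unfolding S_def[abs_def] theta_ratio_def theta_tail_def
  proof (intro continuous_intros)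
    show "\<forall>z\<in>{0..1} \<times> {\<tau>0..\<tau>1}. exp (- ((real n + fst z) * snd z)) *
        real_theta (exp (- snd z)) (- exp (- ((real n + fst z) * snd z))) \<noteq> 0"
    proof
      fix z :: "real \<times> real" assume "z \<in> {0..1} \<times> {\<tau>0..\<tau>1}"
      then have "theta_tail (snd z) ((real n + fst z) * snd z) > 0"
        using \<tau>01 by (intro theta_tail_pos t_pos) auto
      then show "exp (- ((real n + fst z) * snd z)) *
          real_theta (exp (- snd z)) (- exp (- ((real n + fst z) * snd z))) \<noteq> 0"
        unfolding theta_tail_def by (rule less_imp_neq[THEN not_sym])
    qed
  qed (use \<tau>01 in auto)
  have cont1: "continuous_on ({0..1 / 2} \<times> {\<tau>0..\<tau>1}) S"
    by (rule continuous_on_subset[OF S_cont]) auto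
  have cont2: "continuous_on ({0..1 / 2} \<times> {\<tau>0..\<tau>1}) (\<lambda>z. S (fst z + 1 / 2, snd z))"
    by (rule continuous_on_compose2[OF S_cont]) (auto intro!: continuous_intros)
  have S_ge: "S (\<beta>, \<tau>) \<ge> -1" if "\<beta> \<in> {0..1}" "\<tau> > 0" for \<beta> \<tau>
  proof -
    have "theta_tail \<tau> ((real n + \<beta>) * \<tau>) > 0"
      using that by (intro theta_tail_pos t_pos) auto
    then show ?thesis
      using jacobi_theta_exp_nonneg[OF that(2), of \<beta>] that
      by (auto simp: S_def theta_ratio_eq[OF n that(2)])
  qed
  have S_0: "S (0, \<tau>) = -1" and S_1: "S (1, \<tau>) = -1" if "\<tau> > 0" for \<tau>
    using jacobi_theta_exp_0_1[OF that, of 0] jacobi_theta_exp_0_1[OF that, of 1]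
    by (simp_all add: S_def theta_ratio_eq[OF n that])
  obtain \<alpha> \<tau> where *: "\<alpha> \<in> {0..1 / 2}" "\<tau> \<in> {\<tau>0..\<tau>1}"
    "S (\<alpha>, \<tau>) - S (\<alpha> + 1 / 2, \<tau>) = 0" "max (S (\<alpha>, \<tau>)) (S (\<alpha> + 1 / 2, \<tau>)) = 0"
  proof (rule Poincare_Miranda_plane[of 0 "1 / 2" \<tau>0 \<tau>1 "\<lambda>z. S z - S (fst z + 1 / 2, snd z)" "\<lambda>z. max (S z) (S (fst z + 1 / 2, snd z))"])
    show "continuous_on ({0..1 / 2} \<times> {\<tau>0..\<tau>1}) (\<lambda>z. S z - S (fst z + 1 / 2, snd z))"
      "continuous_on ({0..1 / 2} \<times> {\<tau>0..\<tau>1}) (\<lambda>z. max (S z) (S (fst z + 1 / 2, snd z)))"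
      by (intro continuous_intros cont1 cont2)+
    show "S (0, \<tau>) - S (fst (0, \<tau>) + 1 / 2, snd (0, \<tau>)) \<le> 0" if "\<tau> \<in> {\<tau>0..\<tau>1}" for \<tau>
      using S_ge[of "1 / 2" \<tau>] S_0[of \<tau>] \<tau>01 that by simp
    show "S (1 / 2, \<tau>) - S (fst (1 / 2, \<tau>) + 1 / 2, snd (1 / 2, \<tau>)) \<ge> 0" if "\<tau> \<in> {\<tau>0..\<tau>1}" for \<tau>
      using S_ge[of "1 / 2" \<tau>] S_1[of \<tau>] \<tau>01 that by simp
    show "max (S (\<alpha>, \<tau>0)) (S (fst (\<alpha>, \<tau>0) + 1 / 2, snd (\<alpha>, \<tau>0))) \<le> 0" if "\<alpha> \<in> {0..1 / 2}" for \<alpha>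
      using lower[of \<alpha>] lower[of "\<alpha> + 1 / 2"] that by (simp add: S_def)
    \<comment> \<open>One of \<alpha> and \<alpha> + 1 / 2 lies between 1 / 4 and 3 / 4, where
      \<open>upper\<close> applies.\<close>
    show "max (S (\<alpha>, \<tau>1)) (S (fst (\<alpha>, \<tau>1) + 1 / 2, snd (\<alpha>, \<tau>1))) \<ge> 0" if "\<alpha> \<in> {0..1 / 2}" for \<alpha>
      using upper[of \<alpha>] upper[of "\<alpha> + 1 / 2"] that
      by (cases "1 / 4 \<le> \<alpha>") (auto simp: S_def le_max_iff_disj)
  qed (use \<tau>01 in auto)
  have "\<tau> > 0"
    using *(2) \<tau>01 by auto
  have zero: "real_theta (exp (-\<tau>)) (- exp ((real n + \<beta>) * \<tau>)) = 0" if "S (\<beta>, \<tau>) = 0" "\<beta> \<ge> 0" for \<beta>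
    using that theta_tail_pos[OF \<open>\<tau> > 0\<close> t_pos[OF that(2) \<open>\<tau> > 0\<close>]] by (simp add: S_def theta_ratio_def)
  \<comment> \<open>The two values are equal and their maximum is 0.\<close>
  have "S (\<alpha>, \<tau>) = 0" "S (\<alpha> + 1 / 2, \<tau>) = 0"
    using *(3,4) by auto
  moreover have "(real n + (\<alpha> + 1 / 2)) * \<tau> = (real n + \<alpha>) * \<tau> + \<tau> / 2"
    by (simp add: algebra_simps)
  ultimately show ?thesis
    using that[OF *(1,2)] zero[of \<alpha>] zero[of "\<alpha> + 1 / 2"] *(1) by simp
qed

section \<open>Imaginary zeros and the limit of their moduli\<close>

text \<open>With \<open>q = exp (- \<tau> / 4)\<close>, so that
  \<open>q ^ 4 = exp (-\<tau>)\<close>, the numbers \<open>q * x\<^sup>2\<close> and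
  \<open>x\<^sup>2 / q\<close> are the two given zeros. Prescribing only the square of
  \<open>x\<close> covers both signs of the root.\<close>

lemma partial_theta_imaginary_zeros:
  assumes "\<tau> > 0" "real_theta (exp (-\<tau>)) (- exp t) = 0" "real_theta (exp (-\<tau>)) (- exp (t + \<tau> / 2)) = 0"
    and x: "x\<^sup>2 = - complex_of_real (exp (t + \<tau> / 4))"
  shows "partial_theta (exp (- \<tau> / 4)) x = 0"
proof -
  have q: "0 < exp (- \<tau> / 4)" "exp (- \<tau> / 4) < 1" and Q: "0 < exp (-\<tau>)" "exp (-\<tau>) < 1"
    using assms(1) by auto
  have "exp (- \<tau> / 4) ^ 4 = exp (-\<tau>)"
    unfolding exp_of_nat_mult[symmetric] by simp
  moreover have "x\<^sup>2 / exp (- \<tau> / 4) = of_real (- exp (t + \<tau> / 2))"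
    unfolding x of_real_minus[symmetric] of_real_divide[symmetric] of_real_eq_iff
    by (simp add: exp_diff[symmetric])
  moreover have "exp (- \<tau> / 4) * x\<^sup>2 = of_real (- exp t)"
    unfolding x of_real_minus[symmetric] of_real_mult[symmetric] of_real_eq_iff
    by (simp add: exp_add[symmetric])
  ultimately show ?thesis
    unfolding partial_theta_split[OF q] using assms(2,3) by (simp only: partial_theta_of_real[OF Q]) simp
qed

text \<open>The two regimes are joined by \<open>simultaneous_zeros\<close> for one large odd
  \<open>n\<close>. The upper bound \<open>exp 4\<close> does not depend on \<open>T\<close>; it
  provides the compactness for the limit.\<close>

lemma exists_imaginary_zeros:
  assumes "0 < T" "T < pi"
  shows "\<exists>q \<rho>. 0 < q \<and> q < 1 \<and> exp (T / 2) \<le> \<rho> \<and> \<rho> \<le> exp 4 \<and>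
    partial_theta q (\<i> * complex_of_real \<rho>) = 0 \<and> partial_theta q (- (\<i> * complex_of_real \<rho>)) = 0"
proof -
  from eventually_conj[OF eventually_theta_ratio_nonpos[OF assms] eventually_theta_ratio_nonneg]
  obtain N where N: "\<And>n. n \<ge> N \<Longrightarrow> odd n \<Longrightarrow> (\<forall>\<beta>\<in>{0..1}. theta_ratio n (T / real n) \<beta> \<le> 0) \<and>
      (\<forall>\<beta>\<in>{1 / 4..3 / 4}. theta_ratio n (4 / real n) \<beta> \<ge> 0)"
    by (auto simp: eventually_sequentially)
  define n where "n = 2 * N + 1"
  have n: "odd n" "n \<ge> N" "real n \<ge> 1"
    by (auto simp: n_def)
  have "0 < T / real n" "T / real n \<le> 4 / real n"
    using assms n pi_less_4 by (auto intro: divide_right_mono)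
  then obtain \<alpha> \<tau> where *: "\<alpha> \<in> {0..1 / 2}" "\<tau> \<in> {T / real n..4 / real n}"
    "real_theta (exp (-\<tau>)) (- exp ((real n + \<alpha>) * \<tau>)) = 0"
    "real_theta (exp (-\<tau>)) (- exp ((real n + \<alpha>) * \<tau> + \<tau> / 2)) = 0"
    using simultaneous_zeros[OF n(1), of "T / real n" "4 / real n"] N[OF n(2,1)] by auto
  have "\<tau> > 0"
    using *(2) \<open>0 < T / real n\<close> by auto
  define u where "u = (real n + \<alpha>) * \<tau> + \<tau> / 4"
  have nt: "T \<le> real n * \<tau>" "real n * \<tau> \<le> 4"
    using *(2) n(3) by (auto simp: field_simps)
  have "u = real n * \<tau> + (\<alpha> + 1 / 4) * \<tau>"
    by (simp add: u_def algebra_simps)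
  \<comment> \<open>As \<open>\<alpha> + 1 / 4 \<le> 1 \<le> real n\<close>, the correction at most
    doubles \<open>real n * \<tau> \<le> 4\<close>; thus \<open>u \<le> 8\<close>, and the modulus
    \<open>exp (u / 2)\<close> is at most \<open>exp 4\<close>.\<close>
  moreover have "0 \<le> (\<alpha> + 1 / 4) * \<tau>" "(\<alpha> + 1 / 4) * \<tau> \<le> real n * \<tau>"
    using *(1) \<open>\<tau> > 0\<close> n(3) by (auto intro!: mult_right_mono)
  ultimately have u: "T \<le> u" "u \<le> 8"
    using nt by linarith+
  have "exp (u / 2) ^ 2 = exp u"
    unfolding exp_of_nat_mult[symmetric] by simp
  then have "(\<i> * complex_of_real (exp (u / 2)))\<^sup>2 = - complex_of_real (exp u)"
    by (simp add: power_mult_distrib flip: of_real_power)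
  then have "partial_theta (exp (- \<tau> / 4)) (\<i> * complex_of_real (exp (u / 2))) = 0"
    "partial_theta (exp (- \<tau> / 4)) (- (\<i> * complex_of_real (exp (u / 2)))) = 0"
    using partial_theta_imaginary_zeros[OF \<open>\<tau> > 0\<close> *(3,4)] by (simp_all add: u_def)
  then show ?thesis
    using u \<open>\<tau> > 0\<close> by (intro exI[of _ "exp (- \<tau> / 4)"] exI[of _ "exp (u / 2)"]) auto
qed

text \<open>Taking \<open>T = pi - 1 / real (Suc s)\<close> gives moduli in a compact interval with
  lower bounds tending to \<open>exp (pi / 2)\<close>; a convergent subsequence has a limit at least
  that large.\<close>

lemma imaginary_zeros_sequence:
  "\<exists>(q :: nat \<Rightarrow> real) (\<rho> :: nat \<Rightarrow> real).
     (\<forall>s\<ge>1. 0 < q s \<and> q s < 1 \<and> \<rho> s > 0 \<and>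
        partial_theta (q s) (\<i> * complex_of_real (\<rho> s)) = 0 \<and>
        partial_theta (q s) (- (\<i> * complex_of_real (\<rho> s))) = 0) \<and>
     (\<exists>L :: real. \<rho> \<longlonglongrightarrow> L \<and> L \<ge> exp (pi / 2))"
proof -
  have "\<exists>q \<rho>. 0 < q \<and> q < 1 \<and> exp ((pi - 1 / real (Suc s)) / 2) \<le> \<rho> \<and> \<rho> \<le> exp 4 \<and>
      partial_theta q (\<i> * complex_of_real \<rho>) = 0 \<and> partial_theta q (- (\<i> * complex_of_real \<rho>)) = 0" for s
  proof (rule exists_imaginary_zeros)
    have "1 / real (Suc s) \<le> 1"
      by simp
    then show "0 < pi - 1 / real (Suc s)"
      using pi_gt3 by linarith
  qed simp
  then obtain q \<rho> where q: "\<And>s. 0 < q s \<and> q s < 1"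
    and \<rho>: "\<And>s. exp ((pi - 1 / real (Suc s)) / 2) \<le> \<rho> s" "\<And>s. \<rho> s \<le> exp 4"
    and zeros: "\<And>s. partial_theta (q s) (\<i> * complex_of_real (\<rho> s)) = 0 \<and>
      partial_theta (q s) (- (\<i> * complex_of_real (\<rho> s))) = 0"
    by metis
  have \<rho>_pos: "\<rho> s > 0" for s
    using \<rho>(1)[of s] by (meson exp_gt_zero less_le_trans)
  then have "\<forall>s. \<rho> s \<in> {0..exp 4}"
    using \<rho>(2) by (auto intro: less_imp_le)
  then obtain L r where r: "strict_mono (r :: nat \<Rightarrow> nat)" "(\<rho> \<circ> r) \<longlonglongrightarrow> L"
    using compact_Icc[of "0 :: real" "exp 4"] by (metis compact_def compact_imp_seq_compact seq_compact_def)
  have "(\<lambda>s. exp ((pi - 1 / real (Suc s)) / 2)) \<longlonglongrightarrow> exp (pi / 2)"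
    by real_asymp
  then have "((\<lambda>s. exp ((pi - 1 / real (Suc s)) / 2)) \<circ> r) \<longlonglongrightarrow> exp (pi / 2)"
    using r(1) by (rule LIMSEQ_subseq_LIMSEQ)
  then have "exp (pi / 2) \<le> L"
    by (rule LIMSEQ_le[OF _ r(2)]) (use \<rho>(1) in auto)
  then show ?thesis
    using q \<rho>_pos zeros r(2)
    by (intro exI[of _ "q \<circ> r"] exI[of _ "\<rho> \<circ> r"]) auto
qed

section \<open>Absence of zeros in the right half-plane\<close>

text \<open>Exactly the \<open>i\<close> factors with \<open>j < i\<close> are negative.\<close>

lemma prod_one_minus_quotient_sign:
  fixes a :: "nat \<Rightarrow> real"
  assumes "\<And>i. i < N \<Longrightarrow> a i > 0" "\<And>i j. i < j \<Longrightarrow> j < N \<Longrightarrow> a i < a j" "i < N"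
  shows "(-1) ^ i * (\<Prod>j\<in>{..<N} - {i}. 1 - a i / a j) > 0"
proof -
  have split: "{..<N} - {i} = {..<i} \<union> {i<..<N}"
    unfolding set_eq_iff Diff_iff Un_iff lessThan_iff greaterThanLessThan_iff singleton_iff
    using assms(3) by arith
  have "(\<Prod>j\<in>{..<N} - {i}. 1 - a i / a j)
      = (\<Prod>j<i. 1 - a i / a j) * (\<Prod>j\<in>{i<..<N}. 1 - a i / a j)"
    unfolding split by (rule prod.union_disjoint; auto)
  also have "(\<Prod>j<i. 1 - a i / a j) = (\<Prod>j<i. (-1) * (a i / a j - 1))"
    by simp
  also have "\<dots> = (-1) ^ i * (\<Prod>j<i. a i / a j - 1)"
    unfolding prod.distrib by simp
  finally have "(-1) ^ i * (\<Prod>j\<in>{..<N} - {i}. 1 - a i / a j)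
      = (\<Prod>j<i. a i / a j - 1) * (\<Prod>j\<in>{i<..<N}. 1 - a i / a j)"
    by (simp add: mult.assoc[symmetric] power_mult_distrib[symmetric])
  also have "\<dots> > 0"
    using assms by (intro mult_pos_pos prod_pos) auto
  finally show ?thesis .
qed

lemma degree_prod_le_card:
  assumes "finite A" "\<And>j. j \<in> A \<Longrightarrow> degree (f j) \<le> 1"
  shows "degree (\<Prod>j\<in>A. f j) \<le> card A"
proof -
  have "degree (\<Prod>j\<in>A. f j) \<le> (\<Sum>j\<in>A. (degree \<circ> f) j)"
    using degree_prod_sum_le[OF assms(1), of f] by simp
  also have "\<dots> \<le> of_nat (card A) * 1"
    using assms(2) by (intro sum_bounded_above) simp
  finally show ?thesis
    by simp
qed

text \<open>Lagrange interpolation of \<open>r\<close> at the zeros \<open>- a i\<close> of \<open>p\<close> gives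
  \<open>r / p = (\<Sum>i<N. d i / (1 + z / a i))\<close> with positive \<open>d i\<close>, and \<open>x / (1 + x\<^sup>2 / a)\<close> has positive
  real part for \<open>a > 0\<close> and \<open>Re x > 0\<close>.\<close>

lemma Hermite_Biehler_nonzero:
  fixes p r :: "complex poly" and a c :: "nat \<Rightarrow> real"
  assumes p: "degree p \<le> N" "poly p 0 = 1" "\<And>i. i < N \<Longrightarrow> poly p (- of_real (a i)) = 0"
    and r: "degree r < N" "\<And>i. i < N \<Longrightarrow> poly r (- of_real (a i)) = of_real (c i)"
    and c: "\<And>i. i < N \<Longrightarrow> (-1) ^ i * c i > 0"
    and a: "\<And>i. i < N \<Longrightarrow> a i > 0" "\<And>i j. i < j \<Longrightarrow> j < N \<Longrightarrow> a i < a j"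
    and x: "Re x > 0"
  shows "poly p (x\<^sup>2) + x * poly r (x\<^sup>2) \<noteq> 0"
proof -
  define f :: "nat \<Rightarrow> complex poly" where "f j = [:1, 1 / of_real (a j):]" for j
  define d where "d i = c i / (\<Prod>j\<in>{..<N} - {i}. 1 - a i / a j)" for i
  have f_eval: "poly (f j) z = 1 + z / of_real (a j)" for j z
    by (simp add: f_def)
  have deg_f: "degree (f j) \<le> 1" for j
    by (simp add: f_def)
  have inj: "inj_on a {..<N}"
    by (rule linorder_inj_onI') (use a(2) in force)
  then have inj': "inj_on (\<lambda>i. - complex_of_real (a i)) {..<N}"
    by (auto simp: inj_on_def)
  have card: "card ((\<lambda>i. - complex_of_real (a i)) ` {..<N}) = N"
    using card_image[OF inj'] by simp
  have d_pos: "d i > 0" if "i < N" for i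
  proof -
    let ?P = "\<Prod>j\<in>{..<N} - {i}. 1 - a i / a j"
    have "d i = ((-1) ^ i * c i) / ((-1) ^ i * ?P)"
      by (simp add: d_def)
    then show ?thesis
      using divide_pos_pos[OF c[OF that] prod_one_minus_quotient_sign[of N a, OF a that]] by linarith
  qed
  \<comment> \<open>Both degrees are at most \<open>N\<close>, and the polynomials agree at the
    \<open>N + 1\<close> points 0 and \<open>- a i\<close>.\<close>
  have p_eq: "p = (\<Prod>j<N. f j)"
  proof (rule poly_eqI_degree[of "insert 0 ((\<lambda>i. - complex_of_real (a i)) ` {..<N})"])
    have "0 \<notin> (\<lambda>i. - complex_of_real (a i)) ` {..<N}"
      using a(1) by force
    then have *: "card (insert 0 ((\<lambda>i. - complex_of_real (a i)) ` {..<N})) = Suc N"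
      using card by simp
    show "card (insert 0 ((\<lambda>i. - complex_of_real (a i)) ` {..<N})) > degree p"
      using * p(1) by simp
    show "card (insert 0 ((\<lambda>i. - complex_of_real (a i)) ` {..<N})) > degree (\<Prod>j<N. f j)"
      using * degree_prod_le_card[of "{..<N}" f] deg_f by (simp add: less_Suc_eq_le)
    fix z assume "z \<in> insert 0 ((\<lambda>i. - complex_of_real (a i)) ` {..<N})"
    then consider "z = 0" | i where "i < N" "z = - of_real (a i)"
      by auto
    then show "poly p z = poly (\<Prod>j<N. f j) z"
    proof cases
      case 1
      then show ?thesis
        using p(2) by (simp add: poly_prod f_eval)
    next
      case (2 i)
      then have "poly (f i) z = 0"
        using a(1)[of i] by (simp add: f_eval)
      then show ?thesis
        using p(3)[of i] 2 by (auto simp: poly_prod)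
    qed
  qed
  \<comment> \<open>Here the degrees are below \<open>N\<close>, so agreement at the
    \<open>N\<close> points \<open>- a i\<close> suffices.\<close>
  have r_eq: "r = (\<Sum>i<N. smult (of_real (d i)) (\<Prod>j\<in>{..<N} - {i}. f j))"
  proof (rule poly_eqI_degree[of "(\<lambda>i. - complex_of_real (a i)) ` {..<N}"])
    show "card ((\<lambda>i. - complex_of_real (a i)) ` {..<N}) > degree r"
      using card r(1) by simp
    have "degree (smult (of_real (d i)) (\<Prod>j\<in>{..<N} - {i}. f j)) \<le> N - 1" if "i < N" for i
      by (rule order_trans[OF degree_smult_le])
        (use degree_prod_le_card[of "{..<N} - {i}" f] deg_f that in simp)
    then have "degree (\<Sum>i<N. smult (of_real (d i)) (\<Prod>j\<in>{..<N} - {i}. f j)) \<le> N - 1"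
      by (intro degree_sum_le) auto
    then show "card ((\<lambda>i. - complex_of_real (a i)) ` {..<N})
        > degree (\<Sum>i<N. smult (of_real (d i)) (\<Prod>j\<in>{..<N} - {i}. f j))"
      using card r(1) by simp
    fix z assume "z \<in> (\<lambda>i. - complex_of_real (a i)) ` {..<N}"
    then obtain i where i: "i < N" "z = - of_real (a i)"
      by auto
    have zero: "poly (f i) z = 0"
      using a(1)[of i] i by (simp add: f_eval)
    have "poly (\<Sum>i<N. smult (of_real (d i)) (\<Prod>j\<in>{..<N} - {i}. f j)) z
        = (\<Sum>k<N. of_real (d k) * (\<Prod>j\<in>{..<N} - {k}. poly (f j) z))"
      by (simp add: poly_sum poly_prod)
    also have "\<dots> = of_real (d i) * (\<Prod>j\<in>{..<N} - {i}. poly (f j) z)"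
    proof (rule sum.remove[where x = i, THEN trans])
      have "(\<Prod>j\<in>{..<N} - {k}. poly (f j) z) = 0" if "k \<noteq> i" for k
        using zero that i by (intro prod_zero) auto
      then show "of_real (d i) * (\<Prod>j\<in>{..<N} - {i}. poly (f j) z)
          + (\<Sum>k\<in>{..<N} - {i}. of_real (d k) * (\<Prod>j\<in>{..<N} - {k}. poly (f j) z))
          = of_real (d i) * (\<Prod>j\<in>{..<N} - {i}. poly (f j) z)"
        by (simp add: sum.neutral)
    qed (use i in auto)
    also have "(\<Prod>j\<in>{..<N} - {i}. poly (f j) z) = of_real (\<Prod>j\<in>{..<N} - {i}. 1 - a i / a j)"
      by (simp add: f_eval i)
    also have "of_real (d i) * \<dots> = of_real (c i)"
    proof -
      have "(\<Prod>j\<in>{..<N} - {i}. 1 - a i / a j) \<noteq> 0"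
        using prod_one_minus_quotient_sign[of N a, OF a i(1)] by (metis less_irrefl mult_zero_right)
      then have "d i * (\<Prod>j\<in>{..<N} - {i}. 1 - a i / a j) = c i"
        unfolding d_def by (rule nonzero_eq_divide_eq[THEN iffD1, OF _ refl])
      then show ?thesis
        by (simp only: of_real_mult[symmetric])
    qed
    finally show "poly r z = poly (\<Sum>i<N. smult (of_real (d i)) (\<Prod>j\<in>{..<N} - {i}. f j)) z"
      using r(2)[OF i(1)] i(2) by simp
  qed
  have factor: "poly (f i) (x\<^sup>2) \<noteq> 0 \<and> Re (x / poly (f i) (x\<^sup>2)) > 0" if "i < N" for i
  proof -
    have "a i > 0"
      using a(1)[OF that] .
    have "x \<noteq> 0"
      using x by auto
    \<comment> \<open>Up to a positive factor, \<open>w\<close> is \<open>x\<close> divided by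
      \<open>a i + x\<^sup>2\<close>. Its real part \<open>Re x * (a i + |x|^2)\<close> is positive,
      which also shows that the denominator does not vanish.\<close>
    define w where "w = x * cnj (of_real (a i) + x\<^sup>2)"
    have "Re w = Re x * (a i + ((Re x)\<^sup>2 + (Im x)\<^sup>2))"
      by (simp add: w_def power2_eq_square algebra_simps)
    then have "Re w > 0"
      using x \<open>a i > 0\<close> by (simp add: add_pos_nonneg)
    then have nz: "of_real (a i) + x\<^sup>2 \<noteq> 0"
      unfolding w_def by (metis complex_cnj_zero mult_zero_right zero_complex.sel(1) less_irrefl)
    moreover have f_eq: "poly (f i) (x\<^sup>2) = (of_real (a i) + x\<^sup>2) / of_real (a i)"
      using \<open>a i > 0\<close> by (simp add: f_eval field_simps)
    moreover have "x / poly (f i) (x\<^sup>2) = of_real (a i / (norm (of_real (a i) + x\<^sup>2))\<^sup>2) * w"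
    proof -
      have "x / (of_real (a i) + x\<^sup>2) = w / of_real ((norm (of_real (a i) + x\<^sup>2))\<^sup>2)"
        by (simp add: w_def complex_div_cnj[of x])
      moreover have "x / poly (f i) (x\<^sup>2) = of_real (a i) * (x / (of_real (a i) + x\<^sup>2))"
        unfolding f_eq by simp
      ultimately show ?thesis
        by (simp only: of_real_divide times_divide_eq_left times_divide_eq_right)
    qed
    moreover have "Re (of_real (a i / (norm (of_real (a i) + x\<^sup>2))\<^sup>2) * w) > 0"
      using \<open>Re w > 0\<close> \<open>a i > 0\<close> nz by (simp del: of_real_divide)
    ultimately show ?thesis
      using \<open>a i > 0\<close> by auto
  qed
  define P where "P = (\<Prod>j<N. poly (f j) (x\<^sup>2))"
  have "P \<noteq> 0"
    using factor by (auto simp: P_def)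
  have "x * poly r (x\<^sup>2) = (\<Sum>i<N. of_real (d i) * x * (\<Prod>j\<in>{..<N} - {i}. poly (f j) (x\<^sup>2)))"
    by (simp add: r_eq poly_sum poly_prod sum_distrib_left mult_ac)
  also have "\<dots> = (\<Sum>i<N. P * (of_real (d i) * (x / poly (f i) (x\<^sup>2))))"
  proof (rule sum.cong)
    fix i assume "i \<in> {..<N}"
    then have "P = poly (f i) (x\<^sup>2) * (\<Prod>j\<in>{..<N} - {i}. poly (f j) (x\<^sup>2))"
      unfolding P_def by (intro prod.remove) auto
    then show "of_real (d i) * x * (\<Prod>j\<in>{..<N} - {i}. poly (f j) (x\<^sup>2)) = P * (of_real (d i) * (x / poly (f i) (x\<^sup>2)))"
      using factor \<open>i \<in> {..<N}\<close> by simp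
  qed simp
  finally have "poly p (x\<^sup>2) + x * poly r (x\<^sup>2) = P * (1 + (\<Sum>i<N. of_real (d i) * (x / poly (f i) (x\<^sup>2))))"
    by (simp add: p_eq poly_prod P_def sum_distrib_left distrib_left)
  moreover have "Re (1 + (\<Sum>i<N. of_real (d i) * (x / poly (f i) (x\<^sup>2)))) \<ge> 1"
  proof -
    have "Re (of_real (d i) * (x / poly (f i) (x\<^sup>2))) \<ge> 0" if "i < N" for i
    proof -
      have "Re (of_real u * w) = u * Re w" for u w
        by simp
      then show ?thesis
        using factor[OF that] d_pos[OF that] by (simp only: mult_nonneg_nonneg less_imp_le)
    qed
    then show ?thesis
      by (auto simp: Re_sum intro!: sum_nonneg)
  qed
  ultimately show ?thesis
    using \<open>P \<noteq> 0\<close> by (metis mult_eq_0_iff not_one_le_zero zero_complex.sel(1))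
qed

section \<open>Partial sums without zeros in the right half-plane\<close>

lemma theta_partial_sum_zero:
  fixes q :: real
  assumes q: "0 < q" "q + q ^ 3 < 1" and "i < N"
  obtains u where "1 \<le> q ^ (4 * i + 2) * u" "q ^ (4 * i + 4) * u \<le> 1"
    "(\<Sum>j\<le>N. (q ^ 4) ^ (j * (j + 1) div 2) * (- (u / q)) ^ j) = 0"
proof -
  define e where "e u = (-1) ^ i * (\<Sum>j\<le>N. (q ^ 4) ^ (j * (j + 1) div 2) * (- (u / q)) ^ j)" for u
  have "q ^ 3 > 0"
    using q by simp
  with q have "q < 1"
    by linarith
  have pow: "(q ^ 4) ^ (n + 1) * (1 / q ^ m / q) = q ^ (4 * n + 3) / q ^ m" for n m
  proof -
    have "(q ^ 4) ^ (n + 1) = q ^ (4 * n + 3) * q"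
      unfolding power_mult[symmetric] power_Suc2[symmetric] by simp
    then show ?thesis
      using q by simp
  qed
  have e_pos: "e (1 / q ^ (4 * i + 2)) > 0"
  proof -
    have r: "(q ^ 4) ^ (i + 1) * (1 / q ^ (4 * i + 2) / q) = q"
      unfolding pow using q by (simp add: power_add field_simps eval_nat_numeral)
    have "q ^ 3 \<le> q"
      using q \<open>q < 1\<close> by (simp add: power_le_one self_le_power power_decreasing[of 1 3 q, simplified])
    then have "e (1 / q ^ (4 * i + 2)) \<ge> (q ^ 4) ^ (i * (i + 1) div 2) * (1 / q ^ (4 * i + 2) / q) ^ i * (1 - q - q ^ 3)"
      unfolding e_def using \<open>i < N\<close> r by (intro theta_partial_sum_sign q) auto
    moreover have "(q ^ 4) ^ (i * (i + 1) div 2) * (1 / q ^ (4 * i + 2) / q) ^ i * (1 - q - q ^ 3) > 0"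
      using q by simp
    ultimately show ?thesis
      by linarith
  qed
  have e_neg: "e (1 / q ^ (4 * i + 4)) < 0"
  proof -
    have r: "(q ^ 4) ^ (Suc i + 1) * (1 / q ^ (4 * i + 4) / q) = q ^ 3"
      unfolding pow using q by (simp add: power_add field_simps eval_nat_numeral)
    have "q ^ 3 \<le> q"
      using q \<open>q < 1\<close> by (simp add: power_le_one self_le_power power_decreasing[of 1 3 q, simplified])
    then have "- e (1 / q ^ (4 * i + 4)) \<ge> (q ^ 4) ^ (Suc i * (Suc i + 1) div 2) * (1 / q ^ (4 * i + 4) / q) ^ Suc i * (1 - q - q ^ 3)"
      using theta_partial_sum_sign[OF q, of "Suc i" N "1 / q ^ (4 * i + 4) / q"] \<open>i < N\<close> r
      by (simp add: e_def)
    moreover have "(q ^ 4) ^ (Suc i * (Suc i + 1) div 2) * (1 / q ^ (4 * i + 4) / q) ^ Suc i * (1 - q - q ^ 3) > 0"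
      using q by simp
    ultimately show ?thesis
      by linarith
  qed
  have le: "1 / q ^ (4 * i + 2) \<le> 1 / q ^ (4 * i + 4)"
    using q \<open>q < 1\<close> by (intro divide_left_mono power_decreasing) auto
  have "continuous_on {1 / q ^ (4 * i + 2)..1 / q ^ (4 * i + 4)} e"
    unfolding e_def using q by (intro continuous_intros) auto
  then obtain u where u: "1 / q ^ (4 * i + 2) \<le> u" "u \<le> 1 / q ^ (4 * i + 4)" "e u = 0"
    using IVT2'[of e "1 / q ^ (4 * i + 4)" 0 "1 / q ^ (4 * i + 2)"] e_pos e_neg le by auto
  show ?thesis
  proof
    show "1 \<le> q ^ (4 * i + 2) * u" "q ^ (4 * i + 4) * u \<le> 1"
      using u(1,2) q by (auto simp: field_simps)
    show "(\<Sum>j\<le>N. (q ^ 4) ^ (j * (j + 1) div 2) * (- (u / q)) ^ j) = 0"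
      using u(3) by (simp add: e_def)
  qed
qed

text \<open>The last index is even, so the even part has one term more than the odd part; this gives
  \<open>Od\<close> a smaller degree than \<open>Ev\<close> below.\<close>

lemma sum_even_odd_split: "(\<Sum>j\<le>2 * Suc m. h j) = (\<Sum>k\<le>Suc m. h (2 * k)) + (\<Sum>k\<le>m. h (2 * k + 1))"
  for h :: "nat \<Rightarrow> 'a :: comm_monoid_add"
proof (induction m)
  case (Suc m)
  have "2 * Suc (Suc m) = Suc (Suc (2 * Suc m))" "2 * Suc m + 1 = Suc (2 * Suc m)"
    by simp_all
  then have "(\<Sum>j\<le>2 * Suc (Suc m). h j) = (\<Sum>j\<le>2 * Suc m. h j) + h (2 * Suc m + 1) + h (2 * Suc (Suc m))"
    by (simp only: sum.atMost_Suc)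
  then show ?case
    unfolding Suc.IH by (simp only: sum.atMost_Suc add_ac)
qed (simp add: numeral_2_eq_2 add_ac)

text \<open>The sum is \<open>Ev\<close> plus \<open>x\<close> times \<open>Od\<close>, both
  evaluated at \<open>x\<^sup>2\<close>. At the zero \<open>- a i\<close> of \<open>Ev\<close>, the
  location of \<open>a i\<close> puts the term ratio for \<open>Od\<close> between
  \<open>q ^ 3\<close> and \<open>q\<close>, so \<open>Od\<close> has sign \<open>(-1) ^ i\<close>
  there, as \<open>Hermite_Biehler_nonzero\<close> demands.\<close>

lemma partial_theta_section_nonzero:
  fixes q :: real
  assumes q: "0 < q" "q + q ^ 3 < 1" and x: "Re x > 0"
  shows "(\<Sum>j\<le>2 * Suc m. complex_of_real q ^ (j * (j + 1) div 2) * x ^ j) \<noteq> 0"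
proof -
  define Ev Od where "Ev = (\<Sum>k\<le>Suc m. monom (complex_of_real ((q ^ 4) ^ (k * (k + 1) div 2) / q ^ k)) k)"
    and "Od = (\<Sum>k\<le>m. monom (complex_of_real (q * ((q ^ 4) ^ (k * (k + 1) div 2) * q ^ k))) k)"
  have "q ^ 3 > 0"
    using q by simp
  with q have "q < 1"
    by linarith
  have Ev_eval: "poly Ev z = (\<Sum>k\<le>Suc m. (complex_of_real q ^ 4) ^ (k * (k + 1) div 2) * (z / q) ^ k)" for z :: complex
    by (simp add: Ev_def poly_sum poly_monom power_divide)
  have Od_eval: "poly Od z = q * (\<Sum>k\<le>m. (complex_of_real q ^ 4) ^ (k * (k + 1) div 2) * (q * z) ^ k)" for z :: complex
    by (simp add: Od_def poly_sum poly_monom power_mult_distrib sum_distrib_left mult_ac)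
  define Z where "Z i u \<longleftrightarrow> 1 \<le> q ^ (4 * i + 2) * u \<and> q ^ (4 * i + 4) * u \<le> 1 \<and>
      (\<Sum>j\<le>Suc m. (q ^ 4) ^ (j * (j + 1) div 2) * (- (u / q)) ^ j) = 0" for i u
  have "\<exists>u. Z i u" if "i < Suc m" for i
    unfolding Z_def using theta_partial_sum_zero[OF q that] by blast
  then obtain a where Z: "\<And>i. i < Suc m \<Longrightarrow> Z i (a i)"
    by metis
  have a: "1 \<le> q ^ (4 * i + 2) * a i" "q ^ (4 * i + 4) * a i \<le> 1"
    "(\<Sum>j\<le>Suc m. (q ^ 4) ^ (j * (j + 1) div 2) * (- (a i / q)) ^ j) = 0" if "i < Suc m" for i
    using Z[OF that] unfolding Z_def by blast+
  define c where "c i = q * (\<Sum>k\<le>m. (q ^ 4) ^ (k * (k + 1) div 2) * (- (q * a i)) ^ k)" for i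
  have a_pos: "a i > 0" if "i < Suc m" for i
  proof -
    have "q ^ (4 * i + 2) * a i > 0"
      using a(1)[OF that] by linarith
    then show ?thesis
      by (rule zero_less_mult_pos) (use q in simp)
  qed
  have "poly Ev (x\<^sup>2) + x * poly Od (x\<^sup>2) \<noteq> 0"
  proof (rule Hermite_Biehler_nonzero[where a = a and c = c and N = "Suc m"])
    show "degree Ev \<le> Suc m" "degree Od < Suc m"
      unfolding Ev_def Od_def less_Suc_eq_le
      by (intro degree_sum_le; force intro: order_trans[OF degree_monom_le])+
    have "(\<Sum>k\<le>Suc m. (complex_of_real q ^ 4) ^ (k * (k + 1) div 2) * (0 / q) ^ k)
        = (\<Sum>k\<in>{0}. (complex_of_real q ^ 4) ^ (k * (k + 1) div 2) * (0 / q) ^ k)"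
      by (intro sum.mono_neutral_right) auto
    then show "poly Ev 0 = 1"
      unfolding Ev_eval by simp
    fix i assume i: "i < Suc m"
    have "poly Ev (- of_real (a i)) = of_real (\<Sum>j\<le>Suc m. (q ^ 4) ^ (j * (j + 1) div 2) * (- (a i / q)) ^ j)"
      by (simp add: Ev_eval)
    then show "poly Ev (- of_real (a i)) = 0"
      unfolding a(3)[OF i] by simp
    show "poly Od (- of_real (a i)) = of_real (c i)"
      unfolding Od_eval c_def by simp
    show "a i > 0"
      by (rule a_pos[OF i])
    have r: "(q ^ 4) ^ (i + 1) * (q * a i) = q ^ 3 * (q ^ (4 * i + 2) * a i)"
      "(q ^ 4) ^ (i + 1) * (q * a i) = q * (q ^ (4 * i + 4) * a i)"
      by (simp_all only: power_mult[symmetric]) (simp_all add: power_add eval_nat_numeral mult_ac)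
    have "(-1) ^ i * (\<Sum>k\<le>m. (q ^ 4) ^ (k * (k + 1) div 2) * (- (q * a i)) ^ k)
        \<ge> (q ^ 4) ^ (i * (i + 1) div 2) * (q * a i) ^ i * (1 - q - q ^ 3)"
    proof (rule theta_partial_sum_sign[OF q])
      show "q ^ 3 \<le> (q ^ 4) ^ (i + 1) * (q * a i)"
        unfolding r(1) using a(1)[OF i] q by simp
      show "(q ^ 4) ^ (i + 1) * (q * a i) \<le> q"
        unfolding r(2) using a(2)[OF i] q by (simp add: mult_left_le)
    qed (use i in simp)
    moreover have "(q ^ 4) ^ (i * (i + 1) div 2) * (q * a i) ^ i * (1 - q - q ^ 3) > 0"
      using q a_pos[OF i] by simp
    ultimately have "(-1) ^ i * (\<Sum>k\<le>m. (q ^ 4) ^ (k * (k + 1) div 2) * (- (q * a i)) ^ k) > 0"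
      by linarith
    then have "q * ((-1) ^ i * (\<Sum>k\<le>m. (q ^ 4) ^ (k * (k + 1) div 2) * (- (q * a i)) ^ k)) > 0"
      using q by simp
    then show "(-1) ^ i * c i > 0"
      by (simp add: c_def mult.left_commute)
  next
    fix i j assume ij: "i < j" "j < Suc m"
    \<comment> \<open>The intervals that contain \<open>a i\<close> and \<open>a j\<close> are
      disjoint, because \<open>4 * i + 4 < 4 * j + 2\<close>.\<close>
    have "q ^ (4 * j + 2) * a i < q ^ (4 * i + 4) * a i"
      using ij q \<open>q < 1\<close> a_pos[of i] by (intro mult_strict_right_mono power_strict_decreasing) auto
    also have "\<dots> \<le> 1"
      using a(2)[of i] ij by simp
    also have "1 \<le> q ^ (4 * j + 2) * a j"
      using a(1)[of j] ij by simp
    finally show "a i < a j"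
      using q by (simp add: mult_less_cancel_left_pos)
  qed (use x in simp)
  moreover have "(\<Sum>j\<le>2 * Suc m. complex_of_real q ^ (j * (j + 1) div 2) * x ^ j) = poly Ev (x\<^sup>2) + x * poly Od (x\<^sup>2)"
  proof -
    have "complex_of_real q ^ (2 * k * (2 * k + 1) div 2) * x ^ (2 * k)
        = (complex_of_real q ^ 4) ^ (k * (k + 1) div 2) * (x\<^sup>2 / q) ^ k" for k
      by (rule theta_even_term) (use q in simp)
    moreover have "complex_of_real q ^ ((2 * k + 1) * (2 * k + 1 + 1) div 2) * x ^ (2 * k + 1)
        = q * x * ((complex_of_real q ^ 4) ^ (k * (k + 1) div 2) * (q * x\<^sup>2) ^ k)" for k
      by (rule theta_odd_term)
    ultimately show ?thesis
      unfolding sum_even_odd_split Ev_eval Od_eval sum_distrib_left by (simp only: mult_ac)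
  qed
  ultimately show ?thesis
    by simp
qed

section \<open>Passage to the limit and the imaginary axis\<close>

lemma partial_theta_uniform_limit:
  assumes q: "0 < q" "q < 1" and "bounded K"
  shows "uniform_limit K (\<lambda>n x. \<Sum>j<n. complex_of_real q ^ (j * (j + 1) div 2) * x ^ j) (partial_theta q) sequentially"
proof -
  obtain B where B: "\<And>x. x \<in> K \<Longrightarrow> norm x \<le> B"
    using \<open>bounded K\<close> by (auto simp: bounded_iff)
  have "uniform_limit K (\<lambda>n x. \<Sum>j<n. complex_of_real q ^ (j * (j + 1) div 2) * x ^ j)
      (\<lambda>x. \<Sum>j. complex_of_real q ^ (j * (j + 1) div 2) * x ^ j) sequentially"
  proof (rule Weierstrass_m_test)
    show "summable (\<lambda>j. norm (q ^ (j * (j + 1) div 2) * \<bar>B\<bar> ^ j))"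
      by (rule real_theta_summable_norm[OF q])
    fix j x assume "x \<in> K"
    then have "norm x ^ j \<le> \<bar>B\<bar> ^ j"
      using B[of x] by (intro power_mono) auto
    then show "norm (complex_of_real q ^ (j * (j + 1) div 2) * x ^ j) \<le> norm (q ^ (j * (j + 1) div 2) * \<bar>B\<bar> ^ j)"
      using q by (simp add: norm_mult norm_power mult_left_mono)
  qed
  then show ?thesis
    by (simp add: partial_theta_def[abs_def])
qed

lemma partial_theta_holomorphic:
  assumes "0 < q" "q < 1"
  shows "partial_theta q holomorphic_on S"
proof -
  have "partial_theta q holomorphic_on UNIV"
  proof (rule holomorphic_uniform_sequence[where f = "\<lambda>n x. \<Sum>j<n. complex_of_real q ^ (j * (j + 1) div 2) * x ^ j"])
    show "\<exists>d>0. cball x d \<subseteq> UNIV \<and> uniform_limit (cball x d)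
      (\<lambda>n x. \<Sum>j<n. complex_of_real q ^ (j * (j + 1) div 2) * x ^ j) (partial_theta q) sequentially"
      if "x \<in> UNIV" for x
      using partial_theta_uniform_limit[OF assms, of "cball x 1"] by (intro exI[of _ 1]) auto
  qed (auto intro!: holomorphic_intros)
  then show ?thesis
    by (rule holomorphic_on_subset) simp
qed

text \<open>Shows that the partial theta function is not constant, as Hurwitz's theorem requires.
  The terms at 2 are at least those at 1, and strictly larger at index 1.\<close>

lemma real_theta_less:
  assumes q: "0 < q" "q < 1"
  shows "real_theta q 1 < real_theta q 2"
proof -
  have *: "(\<lambda>j. q ^ (j * (j + 1) div 2) * 2 ^ j - q ^ (j * (j + 1) div 2) * 1 ^ j) sums (real_theta q 2 - real_theta q 1)"
    by (intro sums_diff real_theta_sums q)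
  have "0 < (\<Sum>j. q ^ (j * (j + 1) div 2) * 2 ^ j - q ^ (j * (j + 1) div 2) * 1 ^ j)"
    by (rule suminf_pos2[OF sums_summable[OF *], of 1]) (use q in auto)
  then show ?thesis
    using sums_unique[OF *] by simp
qed

lemma partial_theta_nonzero_right_half_plane:
  assumes q: "0 < q" "q + q ^ 3 < 1" and x: "Re x > 0"
  shows "partial_theta q x \<noteq> 0"
proof -
  define F where "F n x = (\<Sum>j\<le>2 * Suc n. complex_of_real q ^ (j * (j + 1) div 2) * x ^ j)" for n x
  have "q ^ 3 > 0"
    using q by simp
  with q have "q < 1"
    by linarith
  show ?thesis
  proof (rule Hurwitz_no_zeros[where S = "{z. Re z > 0}" and \<F> = F and g = "partial_theta q" and ?z0.0 = x])
    show "open {z. Re z > 0}"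
      by (rule open_halfspace_Re_gt)
    show "connected {z. Re z > 0}"
      by (intro convex_connected convex_halfspace_Re_gt)
    show "F n holomorphic_on {z. Re z > 0}" for n
      unfolding F_def[abs_def] by (intro holomorphic_intros)
    show "partial_theta q holomorphic_on {z. Re z > 0}"
      using q(1) \<open>q < 1\<close> by (rule partial_theta_holomorphic)
    show "uniform_limit K F (partial_theta q) sequentially" if "compact K" "K \<subseteq> {z. Re z > 0}" for K
    proof -
      \<comment> \<open>\<open>F\<close> consists of the partial sums with even last index, a
        subsequence of all partial sums.\<close>
      have "filterlim (\<lambda>n. Suc (2 * Suc n)) at_top sequentially"
        by (rule filterlim_subseq) (simp add: strict_mono_def)
      from filterlim_compose[OF partial_theta_uniform_limit[OF q(1) \<open>q < 1\<close> compact_imp_bounded[OF that(1)]] this]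
      show ?thesis
        by (simp only: F_def[abs_def] lessThan_Suc_atMost)
    qed
    show "\<not> partial_theta q constant_on {z. Re z > 0}"
    proof
      assume "partial_theta q constant_on {z. Re z > 0}"
      then have "partial_theta q (of_real 1) = partial_theta q (of_real 2)"
        by (auto simp: constant_on_def)
      then have "real_theta q 1 = real_theta q 2"
        unfolding partial_theta_of_real[OF q(1) \<open>q < 1\<close>] by (simp only: of_real_eq_iff)
      then show False
        using real_theta_less[OF q(1) \<open>q < 1\<close>] by simp
    qed
    show "F n z \<noteq> 0" if "z \<in> {z. Re z > 0}" for n z
      using partial_theta_section_nonzero[OF q] that by (simp add: F_def)
  qed (use x in simp)
qed

text \<open>Hurwitz's theorem says nothing about the boundary. With
  \<open>u = (Im x)\<^sup>2\<close>, the real part is positive for \<open>u < 1\<close> by the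
  Leibniz bounds. Otherwise some power \<open>(q\<^sup>2) ^ m\<close> brings \<open>u\<close> into a
  window where \<open>real_theta_sign\<close> applies, to the real part for even \<open>m\<close>
  and to the imaginary part for odd \<open>m\<close>.\<close>

lemma partial_theta_nonzero_imaginary_axis:
  assumes q: "0 < q" "q + q ^ 3 < 1" and x: "Re x = 0"
  shows "partial_theta q x \<noteq> 0"
proof
  assume zero: "partial_theta q x = 0"
  have "q ^ 3 > 0"
    using q by simp
  with q have "q < 1"
    by linarith
  have q4: "0 < q ^ 4" "q ^ 4 < 1"
    using q \<open>q < 1\<close> by (auto simp: power_less_one_iff)
  define \<rho> u where "\<rho> = Im x" and "u = \<rho>\<^sup>2"
  have x_eq: "x = \<i> * of_real \<rho>"
    using x by (simp add: complex_eq_iff \<rho>_def)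
  then have sq: "x\<^sup>2 / q = of_real (- (u / q))" "q * x\<^sup>2 = of_real (- (q * u))"
    by (simp_all add: power_mult_distrib u_def)
  have "partial_theta q x = of_real (real_theta (q ^ 4) (- (u / q)))
      + \<i> * of_real (q * \<rho> * real_theta (q ^ 4) (- (q * u)))"
    unfolding partial_theta_split[OF q(1) \<open>q < 1\<close>] sq partial_theta_of_real[OF q4]
    by (simp add: x_eq)
  with zero have AB: "real_theta (q ^ 4) (- (u / q)) = 0" "\<rho> * real_theta (q ^ 4) (- (q * u)) = 0"
    using q by (auto simp: complex_eq_iff)
  show False
  proof (cases "u < 1")
    case True
    have "u / q * q ^ 4 = u * q ^ 3"
      using q by (simp add: eval_nat_numeral)
    moreover have "u * q ^ 3 < 1"
    proof -
      have "u * q ^ 3 \<le> 1 * q ^ 3"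
        using True q by (intro mult_right_mono) auto
      also have "\<dots> < 1"
        using q by linarith
      finally show ?thesis .
    qed
    moreover have "u / q \<ge> 0"
      using q by (simp add: u_def)
    ultimately show ?thesis
      using real_theta_pos_bounds(1)[OF q4, of "u / q"] AB(1) by (simp add: mult.commute)
  next
    case False
    define P where "P n \<longleftrightarrow> (q\<^sup>2) ^ n * u < 1" for n
    have "\<exists>n. P n"
    proof -
      have "q\<^sup>2 < 1"
        using q \<open>q < 1\<close> by (simp add: power_less_one_iff)
      then obtain n where "(q\<^sup>2) ^ n < 1 / u"
        using real_arch_pow_inv[of "1 / u" "q\<^sup>2"] False by auto
      then show ?thesis
        using False by (auto simp: P_def field_simps)
    qed
    moreover have "\<not> P 0"
      using False by (simp add: P_def)
    \<comment> \<open>\<open>m\<close> is the last index with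
      \<open>(q\<^sup>2) ^ m * u \<ge> 1\<close>; the windows belonging to consecutive
      \<open>m\<close> leave no gap.\<close>
    ultimately obtain m where "\<not> P m" "P (Suc m)"
      using ex_least_nat_less[of P] by blast
    then have m: "1 \<le> (q\<^sup>2) ^ m * u" "(q\<^sup>2) ^ Suc m * u \<le> 1"
      by (auto simp: P_def)
    show ?thesis
    proof (cases "even m")
      case True
      then obtain n where n: "m = 2 * n" by (elim evenE)
      have "(q ^ 4) ^ (n + 1) * (u / q) = q ^ 3 * ((q\<^sup>2) ^ m * u)"
        "(q ^ 4) ^ (n + 1) * (u / q) = q * ((q\<^sup>2) ^ Suc m * u)"
        using q by (simp_all add: n power_mult[symmetric] power_add field_simps eval_nat_numeral)
      then have "q ^ 3 \<le> (q ^ 4) ^ (n + 1) * (u / q)" "(q ^ 4) ^ (n + 1) * (u / q) \<le> q"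
        using m q by (metis mult_left_le mult_left_mono mult.right_neutral less_imp_le \<open>q ^ 3 > 0\<close>)+
      then show ?thesis
        using real_theta_sign[OF q] AB(1) by fastforce
    next
      case False
      then obtain n where n: "m = 2 * n + 1" by (elim oddE)
      have "(q ^ 4) ^ (n + 1) * (q * u) = q ^ 3 * ((q\<^sup>2) ^ m * u)"
        "(q ^ 4) ^ (n + 1) * (q * u) = q * ((q\<^sup>2) ^ Suc m * u)"
        using q by (simp_all add: n power_mult[symmetric] power_add field_simps eval_nat_numeral)
      then have "q ^ 3 \<le> (q ^ 4) ^ (n + 1) * (q * u)" "(q ^ 4) ^ (n + 1) * (q * u) \<le> q"
        using m q by (metis mult_left_le mult_left_mono mult.right_neutral less_imp_le \<open>q ^ 3 > 0\<close>)+
      then have "real_theta (q ^ 4) (- (q * u)) \<noteq> 0"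
        using real_theta_sign[OF q] by fastforce
      moreover have "\<rho> \<noteq> 0"
        using \<open>\<not> u < 1\<close> by (auto simp: u_def)
      ultimately show ?thesis
        using AB(2) by simp
    qed
  qed
qed

lemma partial_theta_nonzero:
  assumes q: "0 < q" "q \<le> 0.2 powr (1 / 4)" and x: "Re x \<ge> 0"
  shows "partial_theta q x \<noteq> 0"
proof -
  have "q ^ 4 \<le> (0.2 powr (1 / 4)) ^ 4"
    using q by (intro power_mono) auto
  also have "\<dots> = (0.2 :: real)"
    by (simp add: powr_power)
  finally have "q ^ 4 \<le> 0.2" .
  \<comment> \<open>The constant \<open>0.67\<close> fits between two requirements:
    \<open>0.67 ^ 4 > 0.2\<close> and \<open>0.67 + 0.67 ^ 3 < 1\<close>.\<close>
  have "q < 0.67"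
  proof (rule ccontr)
    assume "\<not> q < 0.67"
    then have "0.67 ^ 4 \<le> q ^ 4"
      by (intro power_mono) auto
    then show False
      using \<open>q ^ 4 \<le> 0.2\<close> by (simp add: eval_nat_numeral)
  qed
  then have "q ^ 3 \<le> 0.67 ^ 3"
    using q by (intro power_mono) auto
  then have "q + q ^ 3 < 1"
    using \<open>q < 0.67\<close> by (simp add: eval_nat_numeral)
  then show ?thesis
    using partial_theta_nonzero_right_half_plane[of q x] partial_theta_nonzero_imaginary_axis[of q x] q x
    by linarith
qed

theorem theorem2:
  shows "(\<exists>(q :: nat \<Rightarrow> real) (\<rho> :: nat \<Rightarrow> real).
            (\<forall>s\<ge>1. 0 < q s \<and> q s < 1 \<and> \<rho> s > 0 \<and>
               partial_theta (q s) (\<i> * complex_of_real (\<rho> s)) = 0 \<and>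
               partial_theta (q s) (- (\<i> * complex_of_real (\<rho> s))) = 0) \<and>
            (\<exists>L :: real. \<rho> \<longlonglongrightarrow> L \<and> L \<ge> exp (pi / 2)))
       \<and> (\<forall>q :: real. 0 < q \<and> q \<le> 0.2 powr (1 / 4) \<longrightarrow>
            (\<forall>x :: complex. Re x \<ge> 0 \<longrightarrow> partial_theta q x \<noteq> 0))"
  using imaginary_zeros_sequence partial_theta_nonzero by blast

end
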